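(* Let $\Theta,\Theta'$ be real matrices of dimensions $r\times s$ and $r'\times s'$, and let $\mu,\nu,\iota,\lambda\in\mathbb P_\varepsilon$. Then the Kronecker product of vectors gives a well-defined bilinear pairing $$\otimes:\ ({}^*\mathbb Z^s)^{\mu^s[\iota]}_{\nu^r}(\Theta)\times({}^*\mathbb Z^{s'})^{\nu^{s'}[\lambda]}_{\mu^{r'}}(\Theta')\longrightarrow({}^*\mathbb Z^{ss'})^{\mu^{ss'}\cdot\nu^{ss'}[\iota\cdot\lambda]}_{\iota+\lambda}(\Theta\otimes\Theta').$$ If $r=s$ and $r'=s'$, then the Kronecker product also defines a pairing $$\otimes:\ ({}^*\mathbb Z^r)^{\mu^r[\iota]}_{\nu^r}(\Theta)\times({}^*\mathbb Z^{r'})^{\nu^{r'}[\lambda]}_{\mu^{r'}}(\Theta')\longrightarrow({}^*\mathbb Z^{rr'})^{\mu^{rr'}\cdot\nu^{rr'}[\iota\cdot\lambda]}_{\iota+\lambda}(\Theta\oplus\Theta')\cap({}^*\mathbb Z^{rr'})^{\mu^{rr'}\cdot\nu^{rr'}[\iota\cdot\lambda]}_{\iota+\lambda}(\Theta\ominus\Theta').$$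
   Context: Fix a nonprincipal ultrafilter $\mathfrak u$ on $\mathbb N$, and let ${}^*\mathbb Z\subset{}^*\mathbb R$ be the ultrapowers of $\mathbb Z\subset\mathbb R$. Let ${}^*\mathbb R_{\rm fin}$ be the ring of bounded elements, ${}^*\mathbb R_\varepsilon$ its ideal of infinitesimals, and $({}^*\mathbb R_{\rm fin})^\times_+$ the multiplicative group of positive elements that are neither infinite nor infinitesimal. Let $\mathbb P:=({}^*\mathbb R_{>0}\cup\{0\})/({}^*\mathbb R_{\rm fin})^\times_+$; write $\langle x\rangle\in\mathbb P$ for the class of $|x|$, and $-\infty:=\langle0\rangle$. $\mathbb P$ has the induced product, real powers $\langle x\rangle^t=\langle |x|^t\rangle$ ($t>0$), and total order ($\mu<\mu'$ iff $x<x'$ for all representatives; $-\infty$ is the minimum); $\mu+\nu:=\max(\mu,\nu)$, and $x\cdot\mu:=\langle x\rangle\cdot\mu$ for $x\in{}^*\mathbb R$. $\mathbb P_\varepsilon\subset\mathbb P$ is the set of classes of positive infinitesimals. For a vector $v=(v_1,\dots,v_k)\in{}^*\mathbb R^k$ let $\overline{|v|}:=\max_j|v_j|$. For a real $r\times s$ matrix $\Theta$, ${}^*\mathbb Z^s(\Theta)$ is the group of $n\in{}^*\mathbb Z^s$ for which there is a (unique) $n^\perp\in{}^*\mathbb Z^r$ with $\varepsilon(n):=\Theta n-n^\perp\in{}^*\mathbb R_\varepsilon^r$. For $\mu,\nu,\iota\in\mathbb P_\varepsilon$, $$({}^*\mathbb Z^s)^{\mu[\iota]}_\nu(\Theta):=\{n\in{}^*\mathbb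 Z^s(\Theta):\ \overline{|n|}\cdot\mu^{1/s}<\iota,\ \ \langle\overline{|\varepsilon(n)|}\rangle\le\nu^{1/r}\},$$ a group. $\Theta\otimes\Theta'$ is the Kronecker product (an $rr'\times ss'$ matrix with blocks $\theta_{ij}\Theta'$), and likewise $m\otimes n$ for vectors. For square $\Theta$ ($r\times r$) and $\Theta'$ ($r'\times r'$), $\Theta\oplus\Theta':=\Theta\otimes I_{r'}+I_r\otimes\Theta'$ and $\Theta\ominus\Theta':=\Theta\otimes I_{r'}-I_r\otimes\Theta'$. *)

theory Defs
  imports "HOL-Analysis.Analysis" "HOL-Algebra.Ring"
begin

definition nonprincipal_ultrafilter :: "nat filter \<Rightarrow> bool" where
  "nonprincipal_ultrafilter U \<longleftrightarrow>
     U \<noteq> bot \<and>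
     (\<forall>P. eventually P U \<or> eventually (\<lambda>i. \<not> P i) U) \<and>
     (\<forall>A. U \<noteq> principal A)"


subsection \<open>Ultrapowers\<close>

text \<open>
  The ultrafilter is an explicit parameter, so an element of an ultrapower is an equivalence
  class, i.e. a set of sequences, and the ultrapowers are sets of such classes. For
  \<open>A \<subseteq> UNIV\<close>, \<open>ultrapower U A\<close> is the ultrapower of \<open>A\<close> regarded as a subset of that of \<open>UNIV\<close>.
\<close>

type_synonym 'a ultra = "(nat \<Rightarrow> 'a) set"

definition ucls :: "nat filter \<Rightarrow> (nat \<Rightarrow> 'a) \<Rightarrow> 'a ultra" where
  "ucls U x = {y. \<forall>\<^sub>F i in U. x i = y i}"

definition ultrapower :: "nat filter \<Rightarrow> 'a set \<Rightarrow> 'a ultra set" where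
  "ultrapower U A = {ucls U x | x. \<forall>i. x i \<in> A}"

definition ulift1 :: "nat filter \<Rightarrow> ('a \<Rightarrow> 'b) \<Rightarrow> 'a ultra \<Rightarrow> 'b ultra" where
  "ulift1 U f X = (\<Union>x\<in>X. ucls U (\<lambda>i. f (x i)))"

definition ulift2 :: "nat filter \<Rightarrow> ('a \<Rightarrow> 'b \<Rightarrow> 'c) \<Rightarrow> 'a ultra \<Rightarrow> 'b ultra \<Rightarrow> 'c ultra" where
  "ulift2 U f X Y = (\<Union>x\<in>X. \<Union>y\<in>Y. ucls U (\<lambda>i. f (x i) (y i)))"

definition urel :: "nat filter \<Rightarrow> ('a \<Rightarrow> 'b \<Rightarrow> bool) \<Rightarrow> 'a ultra \<Rightarrow> 'b ultra \<Rightarrow> bool" where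
  "urel U R X Y \<longleftrightarrow> (\<exists>x\<in>X. \<exists>y\<in>Y. \<forall>\<^sub>F i in U. R (x i) (y i))"

lemma ucls_self: "x \<in> ucls U x"
  by (simp add: ucls_def)

lemma ucls_eq_iff: "ucls U x = ucls U y \<longleftrightarrow> (\<forall>\<^sub>F i in U. x i = y i)"
proof
  assume "ucls U x = ucls U y"
  then have "y \<in> ucls U x" by (simp add: ucls_self)
  then show "\<forall>\<^sub>F i in U. x i = y i" by (simp add: ucls_def)
next
  assume eq: "\<forall>\<^sub>F i in U. x i = y i"
  have "(\<forall>\<^sub>F i in U. x i = z i) \<longleftrightarrow> (\<forall>\<^sub>F i in U. y i = z i)" for z
    by (rule eventually_cong[OF eq]) simp
  then show "ucls U x = ucls U y" by (simp add: ucls_def)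
qed

lemma ultrapower_UNIV:
  "ultrapower U UNIV = UNIV // {(x, y). \<forall>\<^sub>F i in U. x i = y i}"
  by (auto simp: ultrapower_def quotient_def ucls_def)

lemma ulift1_ucls: "ulift1 U f (ucls U x) = ucls U (\<lambda>i. f (x i))"
proof -
  have "ucls U (\<lambda>i. f (x' i)) = ucls U (\<lambda>i. f (x i))" if "x' \<in> ucls U x" for x'
    using that unfolding ucls_eq_iff by (auto simp: ucls_def elim: eventually_mono)
  then show ?thesis
    using ucls_self[of x U] unfolding ulift1_def by blast
qed

lemma ulift2_ucls: "ulift2 U f (ucls U x) (ucls U y) = ucls U (\<lambda>i. f (x i) (y i))"
proof -
  have "ucls U (\<lambda>i. f (x' i) (y' i)) = ucls U (\<lambda>i. f (x i) (y i))"
    if "x' \<in> ucls U x" "y' \<in> ucls U y" for x' y'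
    using that unfolding ucls_eq_iff by (auto simp: ucls_def elim: eventually_elim2)
  then show ?thesis
    using ucls_self[of x U] ucls_self[of y U] unfolding ulift2_def by blast
qed

lemma urel_ucls: "urel U R (ucls U x) (ucls U y) \<longleftrightarrow> (\<forall>\<^sub>F i in U. R (x i) (y i))"
proof
  assume "urel U R (ucls U x) (ucls U y)"
  then obtain x' y' where "\<forall>\<^sub>F i in U. x i = x' i" "\<forall>\<^sub>F i in U. y i = y' i"
    "\<forall>\<^sub>F i in U. R (x' i) (y' i)"
    by (auto simp: urel_def ucls_def)
  then show "\<forall>\<^sub>F i in U. R (x i) (y i)"
    by eventually_elim simp
next
  assume "\<forall>\<^sub>F i in U. R (x i) (y i)"
  then show "urel U R (ucls U x) (ucls U y)"
    unfolding urel_def by (intro bexI[of _ x] bexI[of _ y] ucls_self)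
qed


subsection \<open>Hyperreals and hyperintegers\<close>

definition hconst :: "nat filter \<Rightarrow> real \<Rightarrow> real ultra" where
  "hconst U c = ucls U (\<lambda>_. c)"

definition hyperreal :: "nat filter \<Rightarrow> real ultra ring" where
  "hyperreal U =
     \<lparr>carrier = ultrapower U UNIV,
      monoid.mult = ulift2 U (*),
      one = hconst U 1,
      ring.zero = hconst U 0,
      add = ulift2 U (+)\<rparr>"

definition hyperints :: "nat filter \<Rightarrow> real ultra set" where
  "hyperints U = ultrapower U \<int>"

abbreviation hle :: "nat filter \<Rightarrow> real ultra \<Rightarrow> real ultra \<Rightarrow> bool" where
  "hle U \<equiv> urel U (\<le>)"

abbreviation hless :: "nat filter \<Rightarrow> real ultra \<Rightarrow> real ultra \<Rightarrow> bool" where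
  "hless U \<equiv> urel U (<)"

abbreviation habs :: "nat filter \<Rightarrow> real ultra \<Rightarrow> real ultra" where
  "habs U \<equiv> ulift1 U abs"

definition hfin :: "nat filter \<Rightarrow> real ultra set" where
  "hfin U = {X \<in> carrier (hyperreal U). \<exists>c. hle U (habs U X) (hconst U c)}"

definition hinfinitesimal :: "nat filter \<Rightarrow> real ultra set" where
  "hinfinitesimal U = {X \<in> carrier (hyperreal U). \<forall>c>0. hless U (habs U X) (hconst U c)}"

definition hfin_units_pos :: "nat filter \<Rightarrow> real ultra set" where
  "hfin_units_pos U = {X \<in> hfin U. X \<notin> hinfinitesimal U \<and> hless U (hconst U 0) X}"


subsection \<open>The growth-decay semiring\<close>

definition hnonneg :: "nat filter \<Rightarrow> real ultra set" where
  "hnonneg U = {X \<in> carrier (hyperreal U). hless U (hconst U 0) X} \<union> {hconst U 0}"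

definition prel :: "nat filter \<Rightarrow> (real ultra \<times> real ultra) set" where
  "prel U = {(X, Y). X \<in> hnonneg U \<and> Y \<in> hnonneg U \<and>
                     (\<exists>u\<in>hfin_units_pos U. Y = u \<otimes>\<^bsub>hyperreal U\<^esub> X)}"

definition PP :: "nat filter \<Rightarrow> real ultra set set" where
  "PP U = hnonneg U // prel U"

definition pcls :: "nat filter \<Rightarrow> real ultra \<Rightarrow> real ultra set" where
  "pcls U X = prel U `` {habs U X}"

definition pmult :: "nat filter \<Rightarrow> real ultra set \<Rightarrow> real ultra set \<Rightarrow> real ultra set" where
  "pmult U \<mu> \<nu> = (\<Union>X\<in>\<mu>. \<Union>Y\<in>\<nu>. pcls U (X \<otimes>\<^bsub>hyperreal U\<^esub> Y))"

definition ppow :: "nat filter \<Rightarrow> real ultra set \<Rightarrow> real \<Rightarrow> real ultra set" where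
  "ppow U \<mu> t = (\<Union>X\<in>\<mu>. pcls U (ulift1 U (\<lambda>x. x powr t) X))"

definition pless :: "nat filter \<Rightarrow> real ultra set \<Rightarrow> real ultra set \<Rightarrow> bool" where
  "pless U \<mu> \<nu> \<longleftrightarrow> (\<forall>X\<in>\<mu>. \<forall>Y\<in>\<nu>. hless U X Y)"

definition ple :: "nat filter \<Rightarrow> real ultra set \<Rightarrow> real ultra set \<Rightarrow> bool" where
  "ple U \<mu> \<nu> \<longleftrightarrow> pless U \<mu> \<nu> \<or> \<mu> = \<nu>"

definition padd :: "nat filter \<Rightarrow> real ultra set \<Rightarrow> real ultra set \<Rightarrow> real ultra set" where
  "padd U \<mu> \<nu> = (if ple U \<mu> \<nu> then \<nu> else \<mu>)"

definition pscale :: "nat filter \<Rightarrow> real ultra \<Rightarrow> real ultra set \<Rightarrow> real ultra set" where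
  "pscale U X \<mu> = pmult U (pcls U X) \<mu>"

definition PP_eps :: "nat filter \<Rightarrow> real ultra set set" where
  "PP_eps U = {pcls U X | X. X \<in> hinfinitesimal U \<and> hless U (hconst U 0) X}"

lemma PP_eps_subset: "PP_eps U \<subseteq> PP U"
proof
  fix \<mu> assume "\<mu> \<in> PP_eps U"
  then obtain X where \<mu>: "\<mu> = pcls U X" and X: "X \<in> hinfinitesimal U" "hless U (hconst U 0) X"
    by (auto simp: PP_eps_def)
  from X(1) obtain x where x: "X = ucls U x"
    by (auto simp: hinfinitesimal_def hyperreal_def ultrapower_def)
  from X(2) have "\<forall>\<^sub>F i in U. 0 < \<bar>x i\<bar>"
    by (auto simp: x hconst_def urel_ucls elim: eventually_mono)
  then have "habs U X \<in> hnonneg U"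
    by (auto simp: x hnonneg_def hyperreal_def ultrapower_def hconst_def ulift1_ucls urel_ucls)
  then show "\<mu> \<in> PP U"
    by (auto simp: \<mu> PP_def pcls_def intro: quotientI)
qed


subsection \<open>Vectors and matrices\<close>

definition hvec_max :: "nat filter \<Rightarrow> real ultra ^ 'k \<Rightarrow> real ultra" where
  "hvec_max U v = (THE M. M \<in> range (\<lambda>j. habs U (v $ j)) \<and> (\<forall>j. hle U (habs U (v $ j)) M))"

definition hmat_vec :: "nat filter \<Rightarrow> real ^ 's ^ 'r \<Rightarrow> real ultra ^ 's \<Rightarrow> real ultra ^ 'r" where
  "hmat_vec U \<Theta> n =
     (\<chi> i. \<Oplus>\<^bsub>hyperreal U\<^esub>j\<in>UNIV. hconst U (\<Theta> $ i $ j) \<otimes>\<^bsub>hyperreal U\<^esub> (n $ j))"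

definition hvec_add ::
  "nat filter \<Rightarrow> real ultra ^ 'k \<Rightarrow> real ultra ^ 'k \<Rightarrow> real ultra ^ 'k" where
  "hvec_add U v w = (\<chi> j. (v $ j) \<oplus>\<^bsub>hyperreal U\<^esub> (w $ j))"

definition hvec_diff ::
  "nat filter \<Rightarrow> real ultra ^ 'k \<Rightarrow> real ultra ^ 'k \<Rightarrow> real ultra ^ 'k" where
  "hvec_diff U v w = (\<chi> j. (v $ j) \<ominus>\<^bsub>hyperreal U\<^esub> (w $ j))"

definition hvec_group :: "nat filter \<Rightarrow> (real ultra ^ 'k) set \<Rightarrow> (real ultra ^ 'k) monoid" where
  "hvec_group U A = \<lparr>carrier = A, monoid.mult = hvec_add U, one = (\<chi> j. hconst U 0)\<rparr>"

definition hint_vecs :: "nat filter \<Rightarrow> (real ultra ^ 'k) set" where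
  "hint_vecs U = {n. \<forall>j. n $ j \<in> hyperints U}"

definition is_perp ::
  "nat filter \<Rightarrow> real ^ 's ^ 'r \<Rightarrow> real ultra ^ 's \<Rightarrow> real ultra ^ 'r \<Rightarrow> bool" where
  "is_perp U \<Theta> n p \<longleftrightarrow>
     p \<in> hint_vecs U \<and> (\<forall>i. hvec_diff U (hmat_vec U \<Theta> n) p $ i \<in> hinfinitesimal U)"

definition perp ::
  "nat filter \<Rightarrow> real ^ 's ^ 'r \<Rightarrow> real ultra ^ 's \<Rightarrow> real ultra ^ 'r" where
  "perp U \<Theta> n = (THE p. is_perp U \<Theta> n p)"

definition err ::
  "nat filter \<Rightarrow> real ^ 's ^ 'r \<Rightarrow> real ultra ^ 's \<Rightarrow> real ultra ^ 'r" where
  "err U \<Theta> n = hvec_diff U (hmat_vec U \<Theta> n) (perp U \<Theta> n)"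

definition dioph_group :: "nat filter \<Rightarrow> real ^ 's ^ 'r \<Rightarrow> (real ultra ^ 's) set" where
  "dioph_group U \<Theta> = {n \<in> hint_vecs U. \<exists>p. is_perp U \<Theta> n p}"

text \<open>
  \<open>fdioph_group U \<mu> \<iota> \<nu> \<Theta>\<close> renders \<open>({}\<^sup>*\<int>\<^sup>s)\<close> with upper index \<open>\<mu>[\<iota>]\<close> and lower index \<open>\<nu>\<close>
  at \<open>\<Theta>\<close>.
\<close>

definition fdioph_group ::
  "nat filter \<Rightarrow> real ultra set \<Rightarrow> real ultra set \<Rightarrow> real ultra set \<Rightarrow> real ^ 's ^ 'r
     \<Rightarrow> (real ultra ^ 's) set" where
  "fdioph_group U \<mu> \<iota> \<nu> (\<Theta> :: real ^ 's ^ 'r) =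
     {n \<in> dioph_group U \<Theta>.
        pless U (pscale U (hvec_max U n) (ppow U \<mu> (1 / real CARD('s)))) \<iota> \<and>
        ple U (pcls U (hvec_max U (err U \<Theta> n))) (ppow U \<nu> (1 / real CARD('r)))}"


subsection \<open>Kronecker products and sums\<close>

text \<open>
  Rows and columns of a Kronecker product are indexed by pairs: the block at \<open>(i, j)\<close> is
  \<open>\<Theta> $ i $ j\<close> times \<open>\<Theta>'\<close>, and \<open>CARD('r \<times> 'r2) = CARD('r) * CARD('r2)\<close>.
\<close>

definition kron ::
  "real ^ 's ^ 'r \<Rightarrow> real ^ 's2 ^ 'r2 \<Rightarrow> real ^ ('s \<times> 's2) ^ ('r \<times> 'r2)" where
  "kron \<Theta> \<Theta>' = (\<chi> p q. \<Theta> $ fst p $ fst q * \<Theta>' $ snd p $ snd q)"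

definition kron_sum ::
  "real ^ 'r ^ 'r \<Rightarrow> real ^ 'r2 ^ 'r2 \<Rightarrow> real ^ ('r \<times> 'r2) ^ ('r \<times> 'r2)" where
  "kron_sum \<Theta> \<Theta>' = kron \<Theta> (mat 1) + kron (mat 1) \<Theta>'"

definition kron_diff ::
  "real ^ 'r ^ 'r \<Rightarrow> real ^ 'r2 ^ 'r2 \<Rightarrow> real ^ ('r \<times> 'r2) ^ ('r \<times> 'r2)" where
  "kron_diff \<Theta> \<Theta>' = kron \<Theta> (mat 1) - kron (mat 1) \<Theta>'"

definition hvec_kron ::
  "nat filter \<Rightarrow> real ultra ^ 's \<Rightarrow> real ultra ^ 's2 \<Rightarrow> real ultra ^ ('s \<times> 's2)" where
  "hvec_kron U m n = (\<chi> q. (m $ fst q) \<otimes>\<^bsub>hyperreal U\<^esub> (n $ snd q))"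

definition bilinear_pairing ::
  "('a \<Rightarrow> 'b \<Rightarrow> 'c) \<Rightarrow> 'a monoid \<Rightarrow> 'b monoid \<Rightarrow> 'c monoid \<Rightarrow> bool" where
  "bilinear_pairing f G H K \<longleftrightarrow>
     comm_group G \<and> comm_group H \<and> comm_group K \<and>
     (\<forall>n\<in>carrier H. (\<lambda>m. f m n) \<in> hom G K) \<and>
     (\<forall>m\<in>carrier G. f m \<in> hom H K)"

end

theory Submission
  imports Defs
begin

text \<open>
  Everything is computed on representing sequences: order and arithmetic in the semiring of growth
  classes become inequalities, up to real constants, that hold eventually along the ultrafilter.
  Since hyperinteger vectors are zero or of norm at least 1, \<open>\<Theta>m - m\<^sup>\<bottom>\<close> infinitesimal forces
  \<open>|m\<^sup>\<bottom>| \<le> K |m|\<close> for a real \<open>K\<close>. Hence in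
  \<open>\<Theta>m \<otimes> \<Theta>'n - m\<^sup>\<bottom> \<otimes> n\<^sup>\<bottom> = \<epsilon>(m) \<otimes> \<Theta>'n + m\<^sup>\<bottom> \<otimes> \<epsilon>(n)\<close> the first term is at most of class
  \<open>\<nu> |n| < \<kappa>\<close> and the second of class \<open>\<mu> |m| < \<iota>\<close>; the Kronecker sum and difference have the errors
  \<open>\<epsilon>(m) \<otimes> n \<plusminus> m \<otimes> \<epsilon>(n)\<close>, bounded the same way. Taking roots only enlarges infinitesimals, so the
  bound \<open>\<iota> + \<kappa>\<close> is stronger than the one demanded.
\<close>

section \<open>Hypervectors as classes of sequences of real vectors\<close>

text \<open>One sequence of real vectors represents all coordinates at once, so operations on
  hypervectors can be carried out index by index.\<close>

definition uvec :: "nat filter \<Rightarrow> (nat \<Rightarrow> real ^ 'k) \<Rightarrow> real ultra ^ 'k" where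
  "uvec U v = (\<chi> j. ucls U (\<lambda>i. v i $ j))"

lemma uvec_nth [simp]: "uvec U v $ j = ucls U (\<lambda>i. v i $ j)"
  by (simp add: uvec_def)

lemma carrier_hyperreal [simp]: "carrier (hyperreal U) = range (ucls U)"
  by (auto simp: hyperreal_def ultrapower_def)

lemma hyperreal_mult [simp]: "ucls U x \<otimes>\<^bsub>hyperreal U\<^esub> ucls U y = ucls U (\<lambda>i. x i * y i)"
  by (simp add: hyperreal_def ulift2_ucls)

lemma hyperreal_add [simp]: "ucls U x \<oplus>\<^bsub>hyperreal U\<^esub> ucls U y = ucls U (\<lambda>i. x i + y i)"
  by (simp add: hyperreal_def ulift2_ucls)

lemma hyperreal_zero [simp]: "\<zero>\<^bsub>hyperreal U\<^esub> = ucls U (\<lambda>_. 0)"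
  by (simp add: hyperreal_def hconst_def)

lemma abelian_group_hyperreal: "abelian_group (hyperreal U)"
proof (rule abelian_groupI)
  fix X assume "X \<in> carrier (hyperreal U)"
  then obtain x where "X = ucls U x" by auto
  then show "\<exists>Y\<in>carrier (hyperreal U). Y \<oplus>\<^bsub>hyperreal U\<^esub> X = \<zero>\<^bsub>hyperreal U\<^esub>"
    by (intro bexI[of _ "ucls U (\<lambda>i. - x i)"]) auto
qed (auto simp: add_ac)

lemma hyperreal_minus [simp]: "ucls U x \<ominus>\<^bsub>hyperreal U\<^esub> ucls U y = ucls U (\<lambda>i. x i - y i)"
proof -
  interpret abelian_group "hyperreal U" by (rule abelian_group_hyperreal)
  have "\<ominus>\<^bsub>hyperreal U\<^esub> ucls U y = ucls U (\<lambda>i. - y i)"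
    by (rule minus_equality) auto
  then show ?thesis by (simp add: a_minus_def)
qed

lemma hyperreal_finsum:
  assumes "finite A"
  shows "(\<Oplus>\<^bsub>hyperreal U\<^esub>j\<in>A. ucls U (x j)) = ucls U (\<lambda>i. \<Sum>j\<in>A. x j i)"
proof -
  interpret abelian_group "hyperreal U" by (rule abelian_group_hyperreal)
  show ?thesis using assms by induction (auto simp: Pi_def)
qed

lemma hmat_vec_uvec: "hmat_vec U \<Theta> (uvec U v) = uvec U (\<lambda>i. \<Theta> *v v i)"
  by (simp add: hmat_vec_def vec_eq_iff hconst_def hyperreal_finsum matrix_vector_mult_def)

lemma hvec_add_uvec: "hvec_add U (uvec U v) (uvec U w) = uvec U (\<lambda>i. v i + w i)"
  by (simp add: hvec_add_def vec_eq_iff)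

lemma hvec_diff_uvec: "hvec_diff U (uvec U v) (uvec U w) = uvec U (\<lambda>i. v i - w i)"
  by (simp add: hvec_diff_def vec_eq_iff)

lemma hvec_zero: "(\<chi> j. hconst U 0) = uvec U (\<lambda>_. 0)"
  by (simp add: hconst_def vec_eq_iff)

section \<open>Kronecker products of real vectors and the maximum norm\<close>

definition vkron :: "real ^ 's \<Rightarrow> real ^ 't \<Rightarrow> real ^ ('s \<times> 't)" where
  "vkron x y = (\<chi> q. x $ fst q * y $ snd q)"

lemma hvec_kron_uvec: "hvec_kron U (uvec U v) (uvec U w) = uvec U (\<lambda>i. vkron (v i) (w i))"
  by (simp add: hvec_kron_def vec_eq_iff vkron_def)

lemma vkron_distribs:
  "vkron (x + x') y = vkron x y + vkron x' y"
  "vkron x (y + y') = vkron x y + vkron x y'"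
  "vkron (x - x') y = vkron x y - vkron x' y"
  "vkron x (y - y') = vkron x y - vkron x y'"
  by (simp_all add: vkron_def vec_eq_iff algebra_simps)

text \<open>The mixed-product rule: the sum over pairs of indices separates into a product of two
  sums.\<close>

lemma kron_mult_vkron: "kron A B *v vkron x y = vkron (A *v x) (B *v y)"
  by (simp add: vec_eq_iff kron_def vkron_def matrix_vector_mult_def sum_product
      sum.cartesian_product UNIV_Times_UNIV[symmetric] case_prod_unfold mult_ac
      del: UNIV_Times_UNIV)

lemma kron_sum_mult_vkron: "kron_sum A B *v vkron x y = vkron (A *v x) y + vkron x (B *v y)"
  by (simp add: kron_sum_def matrix_vector_mult_add_rdistrib kron_mult_vkron)

lemma kron_diff_mult_vkron: "kron_diff A B *v vkron x y = vkron (A *v x) y - vkron x (B *v y)"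
  by (simp add: kron_diff_def matrix_vector_mult_diff_rdistrib kron_mult_vkron)

text \<open>The supremum defining \<open>infnorm\<close> runs over finitely many coordinates, hence
  is a maximum; this makes \<open>infnorm\<close> the pointwise form of
  \<open>hvec_max\<close>.\<close>

lemma infnorm_attained_cart:
  fixes x :: "real ^ 'n"
  obtains j where "infnorm x = \<bar>x $ j\<bar>"
proof -
  have "infnorm x = Max (range (\<lambda>i. \<bar>x $ i\<bar>))"
    by (simp add: infnorm_cart full_SetCompr_eq cSup_eq_Max)
  also have "\<dots> \<in> range (\<lambda>i. \<bar>x $ i\<bar>)" by (intro Max_in) auto
  finally show ?thesis using that by auto
qed

lemma infnorm_vkron: "infnorm (vkron x y) \<le> infnorm x * infnorm y"
proof -
  obtain q where "infnorm (vkron x y) = \<bar>vkron x y $ q\<bar>" by (rule infnorm_attained_cart)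
  then show ?thesis
    by (auto simp: vkron_def abs_mult infnorm_pos_le intro!: mult_mono component_le_infnorm_cart)
qed

lemma infnorm_diff_le: "infnorm (x - y) \<le> infnorm x + infnorm y"
  using infnorm_triangle[of x "- y"] by (simp add: infnorm_neg)

text \<open>A matrix is a bounded operator for the Euclidean norm; the equivalence of norms in
  finite dimension carries the bound over, at the cost of the factor \<open>?d\<close>.\<close>

lemma infnorm_matrix_vector_bound:
  fixes A :: "real ^ 's ^ 'r"
  obtains K where "K > 0" "\<And>x. infnorm (A *v x) \<le> K * infnorm x"
proof -
  obtain B where B: "B > 0" "\<And>x. norm (A *v x) \<le> norm x * B"
    using bounded_linear.pos_bounded[OF matrix_vector_mul_bounded_linear[of A]] by blast
  let ?d = "sqrt (real DIM(real ^ 's))"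
  have "infnorm (A *v x) \<le> (B * ?d) * infnorm x" for x
  proof -
    have "infnorm (A *v x) \<le> norm (A *v x)" by (rule infnorm_le_norm)
    also have "\<dots> \<le> norm x * B" by (rule B)
    also have "\<dots> \<le> (?d * infnorm x) * B"
      using B(1) norm_le_infnorm[of x] by (intro mult_right_mono) auto
    finally show ?thesis by (simp add: mult_ac)
  qed
  then show ?thesis using B(1) by (intro that[of "B * ?d"]) auto
qed

text \<open>Discreteness of the integers. It gives the uniqueness of the \<open>perp\<close>, and
  norm at least 1 for nonzero integer vectors.\<close>

lemma Ints_vec_zero:
  fixes x :: "real ^ 'n"
  assumes "\<And>j. x $ j \<in> \<int>" "infnorm x < 1"
  shows "x = 0"
proof -
  have "x $ j = 0" for j
    using component_le_infnorm_cart[of x j] assms(2) assms(1)[of j]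
    by (metis Ints_nonzero_abs_less1 order_le_less_trans)
  then show ?thesis by (simp add: vec_eq_iff)
qed

section \<open>Growth classes in terms of representing sequences\<close>

context
  fixes U :: "nat filter"
  assumes nu: "nonprincipal_ultrafilter U"
begin

text \<open>Maximality of the ultrafilter gives one direction and properness the other. Through it a
  failed estimate becomes an opposite estimate that holds eventually.\<close>

lemma ultra_not_iff: "\<not> eventually P U \<longleftrightarrow> (\<forall>\<^sub>F i in U. \<not> P i)"
proof
  assume *: "\<forall>\<^sub>F i in U. \<not> P i"
  show "\<not> eventually P U"
  proof
    assume "eventually P U"
    with * have "eventually (\<lambda>_. False) U" by eventually_elim simp
    with nu show False by (simp add: nonprincipal_ultrafilter_def trivial_limit_def)
  qed
qed (use nu in \<open>auto simp: nonprincipal_ultrafilter_def\<close>)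

text \<open>Otherwise each of the finitely many properties would fail eventually, hence all of them
  would fail at once, contrary to the assumption.\<close>

lemma ultra_finite_choice:
  assumes "\<forall>\<^sub>F i in U. \<exists>j::'k::finite. P i j"
  obtains j where "\<forall>\<^sub>F i in U. P i j"
proof (rule ccontr)
  assume "\<not> thesis"
  then have "\<not> eventually (\<lambda>i. P i j) U" for j using that by blast
  then have "\<forall>j. \<forall>\<^sub>F i in U. \<not> P i j" by (simp add: ultra_not_iff)
  then have "\<forall>\<^sub>F i in U. \<forall>j. \<not> P i j" by (simp add: eventually_all_finite)
  with assms have "\<forall>\<^sub>F i in U. False" by eventually_elim auto
  then show False using ultra_not_iff[of "\<lambda>_. False"] by simp
qed

text \<open>The ultrafilter decides whether \<open>x\<close> vanishes, so a class of nonnegative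
  values is either zero or positive, which are the two cases of \<open>hnonneg\<close>.\<close>

lemma hnonneg_ucls: "ucls U x \<in> hnonneg U \<longleftrightarrow> (\<forall>\<^sub>F i in U. 0 \<le> x i)"
proof
  assume "\<forall>\<^sub>F i in U. 0 \<le> x i"
  then have "\<forall>\<^sub>F i in U. 0 < x i" if "\<forall>\<^sub>F i in U. x i \<noteq> 0"
    using that by eventually_elim simp
  then have "(\<forall>\<^sub>F i in U. x i = 0) \<or> (\<forall>\<^sub>F i in U. 0 < x i)"
    using ultra_not_iff[of "\<lambda>i. x i = 0"] by blast
  then show "ucls U x \<in> hnonneg U"
    by (auto simp: hnonneg_def hconst_def urel_ucls ucls_eq_iff)
qed (auto simp: hnonneg_def hconst_def urel_ucls ucls_eq_iff intro: less_imp_le elim: eventually_mono)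

text \<open>Neither infinite nor infinitesimal means bounded above and away from 0; a single real
  \<open>C\<close> records both bounds.\<close>

lemma hfin_units_pos_ucls:
  "ucls U u \<in> hfin_units_pos U \<longleftrightarrow> (\<exists>C>0. \<forall>\<^sub>F i in U. 1 \<le> C * u i \<and> u i \<le> C)"
proof
  assume "ucls U u \<in> hfin_units_pos U"
  then obtain c d where c: "\<forall>\<^sub>F i in U. \<bar>u i\<bar> \<le> c" and d: "d > 0" "\<forall>\<^sub>F i in U. \<not> \<bar>u i\<bar> < d"
    and pos: "\<forall>\<^sub>F i in U. 0 < u i"
    by (auto simp: hfin_units_pos_def hfin_def hinfinitesimal_def hconst_def urel_ucls ulift1_ucls
        ultra_not_iff)
  define C where "C = max c (1 / d)"
  have C: "C > 0" "c \<le> C" using d(1) by (auto simp: C_def less_max_iff_disj)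
  have "1 / d * d \<le> C * d" using d(1) by (intro mult_right_mono) (auto simp: C_def)
  then have C': "1 \<le> C * d" using d(1) by simp
  from c d(2) pos have "\<forall>\<^sub>F i in U. 1 \<le> C * u i \<and> u i \<le> C"
  proof eventually_elim
    case (elim i)
    then have "C * d \<le> C * u i" using C(1) by (intro mult_left_mono) auto
    with elim C C' show ?case by linarith
  qed
  with C show "\<exists>C>0. \<forall>\<^sub>F i in U. 1 \<le> C * u i \<and> u i \<le> C" by blast
next
  assume "\<exists>C>0. \<forall>\<^sub>F i in U. 1 \<le> C * u i \<and> u i \<le> C"
  then obtain C where C: "C > 0" "\<forall>\<^sub>F i in U. 1 \<le> C * u i \<and> u i \<le> C" by blast
  have *: "\<forall>\<^sub>F i in U. 1 / C \<le> u i \<and> u i \<le> C \<and> 0 < u i"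
    using C(2)
  proof eventually_elim
    case (elim i)
    then have "1 / C \<le> u i" using C(1) by (simp add: field_simps)
    moreover have "0 < 1 / C" using C(1) by simp
    ultimately show ?case using elim by linarith
  qed
  then have "\<forall>\<^sub>F i in U. \<bar>u i\<bar> \<le> C" "\<forall>\<^sub>F i in U. 0 < u i" "\<forall>\<^sub>F i in U. \<not> \<bar>u i\<bar> < 1 / C"
    by (auto elim: eventually_mono)
  moreover from this(3) C(1) have "\<exists>c>0. \<not> (\<forall>\<^sub>F i in U. \<bar>u i\<bar> < c)"
    by (intro exI[of _ "1 / C"]) (simp add: ultra_not_iff)
  ultimately show "ucls U u \<in> hfin_units_pos U"
    by (auto simp: hfin_units_pos_def hfin_def hinfinitesimal_def hconst_def urel_ucls ulift1_ucls)
qed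

text \<open>A unit multiplier stays between \<open>1 / C\<close> and \<open>C\<close>, so class
  membership is a two-sided comparison. The first inequality also forces \<open>z\<close> to be
  nonnegative eventually.\<close>

lemma mem_pcls_iff:
  "Z \<in> pcls U (ucls U x) \<longleftrightarrow>
     (\<exists>z. Z = ucls U z \<and> (\<exists>C>0. \<forall>\<^sub>F i in U. \<bar>x i\<bar> \<le> C * z i \<and> z i \<le> C * \<bar>x i\<bar>))"
proof
  assume "Z \<in> pcls U (ucls U x)"
  then obtain w where w: "w \<in> hfin_units_pos U" and Z: "Z = w \<otimes>\<^bsub>hyperreal U\<^esub> ucls U (\<lambda>i. \<bar>x i\<bar>)"
    by (auto simp: pcls_def prel_def ulift1_ucls)
  obtain u where u: "w = ucls U u" using w by (auto simp: hfin_units_pos_def hfin_def)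
  obtain C where C: "C > 0" "\<forall>\<^sub>F i in U. 1 \<le> C * u i \<and> u i \<le> C"
    using w hfin_units_pos_ucls by (auto simp: u)
  from C(2) have "\<forall>\<^sub>F i in U. \<bar>x i\<bar> \<le> C * (u i * \<bar>x i\<bar>) \<and> u i * \<bar>x i\<bar> \<le> C * \<bar>x i\<bar>"
  proof eventually_elim
    case (elim i)
    then have "1 * \<bar>x i\<bar> \<le> (C * u i) * \<bar>x i\<bar>" "u i * \<bar>x i\<bar> \<le> C * \<bar>x i\<bar>"
      by (intro mult_right_mono; simp)+
    then show ?case by (simp add: mult.assoc)
  qed
  with C Z u show "\<exists>z. Z = ucls U z \<and> (\<exists>C>0. \<forall>\<^sub>F i in U. \<bar>x i\<bar> \<le> C * z i \<and> z i \<le> C * \<bar>x i\<bar>)"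
    by auto
next
  assume "\<exists>z. Z = ucls U z \<and> (\<exists>C>0. \<forall>\<^sub>F i in U. \<bar>x i\<bar> \<le> C * z i \<and> z i \<le> C * \<bar>x i\<bar>)"
  then obtain z C where Z: "Z = ucls U z" and C: "C > 0"
    and ev: "\<forall>\<^sub>F i in U. \<bar>x i\<bar> \<le> C * z i \<and> z i \<le> C * \<bar>x i\<bar>" by auto
  \<comment> \<open>The multiplier taking the absolute value of \<open>x\<close> to
    \<open>z\<close>. Where \<open>x\<close> vanishes the two bounds make \<open>z\<close> vanish
    too, and the default 1 keeps the multiplier within unit bounds.\<close>
  define u where "u i = (if x i = 0 then 1 else z i / \<bar>x i\<bar>)" for i
  \<comment> \<open>Taking at least 1 makes the bounds hold for the default value of
    \<open>u\<close> as well.\<close>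
  define D where "D = max 1 C"
  have D: "D > 0" "1 \<le> D" "C \<le> D" by (auto simp: D_def)
  have z0: "\<forall>\<^sub>F i in U. 0 \<le> z i"
    using ev
  proof eventually_elim
    case (elim i)
    then have "0 \<le> C * z i" using abs_ge_zero[of "x i"] by linarith
    then show ?case using C by (simp add: zero_le_mult_iff)
  qed
  have "\<forall>\<^sub>F i in U. 1 \<le> D * u i \<and> u i \<le> D"
    using ev z0
  proof eventually_elim
    case (elim i)
    have "C * z i \<le> D * z i" "C * \<bar>x i\<bar> \<le> D * \<bar>x i\<bar>"
      using elim D by (auto intro: mult_right_mono)
    with elim have "\<bar>x i\<bar> \<le> D * z i" "z i \<le> D * \<bar>x i\<bar>" by linarith+
    with D show ?case by (simp add: u_def field_simps)
  qed
  then have "ucls U u \<in> hfin_units_pos U" using D hfin_units_pos_ucls by blast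
  moreover have "\<forall>\<^sub>F i in U. z i = u i * \<bar>x i\<bar>"
    using ev z0 by eventually_elim (auto simp: u_def)
  then have "ucls U z = ucls U u \<otimes>\<^bsub>hyperreal U\<^esub> ucls U (\<lambda>i. \<bar>x i\<bar>)"
    by (simp add: ucls_eq_iff)
  ultimately show "Z \<in> pcls U (ucls U x)"
    using z0 hnonneg_ucls[of z] unfolding pcls_def prel_def ulift1_ucls Z
    by (auto simp: hnonneg_ucls simp del: hyperreal_mult)
qed

lemma abs_mem_pcls: "ucls U (\<lambda>i. \<bar>x i\<bar>) \<in> pcls U (ucls U x)"
  unfolding mem_pcls_iff by (auto intro!: exI[of _ "\<lambda>i. \<bar>x i\<bar>"] exI[of _ "1::real"])

text \<open>An absolute value lies in its own class, so equality gives a membership; conversely,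
  comparisons compose with their constants multiplied.\<close>

lemma pcls_eq_iff:
  "pcls U (ucls U x) = pcls U (ucls U y) \<longleftrightarrow>
     (\<exists>C>0. \<forall>\<^sub>F i in U. \<bar>x i\<bar> \<le> C * \<bar>y i\<bar> \<and> \<bar>y i\<bar> \<le> C * \<bar>x i\<bar>)"
proof
  assume "pcls U (ucls U x) = pcls U (ucls U y)"
  then have "ucls U (\<lambda>i. \<bar>y i\<bar>) \<in> pcls U (ucls U x)" using abs_mem_pcls[of y] by simp
  then obtain z C where "C > 0" and yz: "\<forall>\<^sub>F i in U. \<bar>y i\<bar> = z i"
    and ev: "\<forall>\<^sub>F i in U. \<bar>x i\<bar> \<le> C * z i \<and> z i \<le> C * \<bar>x i\<bar>"
    by (auto simp: mem_pcls_iff ucls_eq_iff)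
  from yz ev have "\<forall>\<^sub>F i in U. \<bar>x i\<bar> \<le> C * \<bar>y i\<bar> \<and> \<bar>y i\<bar> \<le> C * \<bar>x i\<bar>" by eventually_elim simp
  with \<open>C > 0\<close> show "\<exists>C>0. \<forall>\<^sub>F i in U. \<bar>x i\<bar> \<le> C * \<bar>y i\<bar> \<and> \<bar>y i\<bar> \<le> C * \<bar>x i\<bar>" by blast
next
  have sub: "pcls U (ucls U x) \<subseteq> pcls U (ucls U y)"
    if C: "C > 0" "\<forall>\<^sub>F i in U. \<bar>x i\<bar> \<le> C * \<bar>y i\<bar> \<and> \<bar>y i\<bar> \<le> C * \<bar>x i\<bar>" for x y :: "nat \<Rightarrow> real" and C
  proof
    fix Z assume "Z \<in> pcls U (ucls U x)"
    then obtain z D where Z: "Z = ucls U z" and D: "D > 0"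
      "\<forall>\<^sub>F i in U. \<bar>x i\<bar> \<le> D * z i \<and> z i \<le> D * \<bar>x i\<bar>"
      by (auto simp: mem_pcls_iff)
    from C(2) D(2) have "\<forall>\<^sub>F i in U. \<bar>y i\<bar> \<le> (C * D) * z i \<and> z i \<le> (C * D) * \<bar>y i\<bar>"
    proof eventually_elim
      case (elim i)
      have "C * \<bar>x i\<bar> \<le> C * (D * z i)" "D * \<bar>x i\<bar> \<le> D * (C * \<bar>y i\<bar>)"
        using elim C(1) D(1) by auto
      with elim show ?case by (simp add: mult_ac)
    qed
    moreover have "C * D > 0" using C(1) D(1) by simp
    ultimately show "Z \<in> pcls U (ucls U y)"
      unfolding mem_pcls_iff Z by blast
  qed
  assume "\<exists>C>0. \<forall>\<^sub>F i in U. \<bar>x i\<bar> \<le> C * \<bar>y i\<bar> \<and> \<bar>y i\<bar> \<le> C * \<bar>x i\<bar>"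
  then obtain C where "C > 0" "\<forall>\<^sub>F i in U. \<bar>x i\<bar> \<le> C * \<bar>y i\<bar> \<and> \<bar>y i\<bar> \<le> C * \<bar>x i\<bar>" by blast
  then show "pcls U (ucls U x) = pcls U (ucls U y)"
    using sub[of C x y] sub[of C y x] by (simp add: conj_commute)
qed

lemma pcls_eqI:
  assumes "Z \<in> pcls U (ucls U x)" "Z = ucls U z"
  shows "pcls U (ucls U z) = pcls U (ucls U x)"
proof -
  obtain z' C where "C > 0" and eq: "\<forall>\<^sub>F i in U. z i = z' i"
    and ev: "\<forall>\<^sub>F i in U. \<bar>x i\<bar> \<le> C * z' i \<and> z' i \<le> C * \<bar>x i\<bar>"
    using assms by (auto simp: mem_pcls_iff ucls_eq_iff)
  from eq ev have "\<forall>\<^sub>F i in U. \<bar>z i\<bar> \<le> C * \<bar>x i\<bar> \<and> \<bar>x i\<bar> \<le> C * \<bar>z i\<bar>"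
  proof eventually_elim
    case (elim i)
    have "0 \<le> C * z' i" using elim abs_ge_zero[of "x i"] by linarith
    then have "0 \<le> z' i" using \<open>C > 0\<close> by (simp add: zero_le_mult_iff)
    with elim show ?case by simp
  qed
  with \<open>C > 0\<close> show ?thesis by (auto simp: pcls_eq_iff)
qed

text \<open>Every positive real multiple of the absolute value of \<open>x\<close> represents the
  same class; hence comparing all representatives amounts to allowing an arbitrary constant
  \<open>C\<close>.\<close>

lemma pless_pcls_iff:
  "pless U (pcls U (ucls U x)) (pcls U (ucls U y)) \<longleftrightarrow> (\<forall>C>0. \<forall>\<^sub>F i in U. C * \<bar>x i\<bar> < \<bar>y i\<bar>)"
proof (intro iffI allI impI)
  fix C :: real
  assume "pless U (pcls U (ucls U x)) (pcls U (ucls U y))" and C: "C > 0"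
  moreover have "ucls U (\<lambda>i. C * \<bar>x i\<bar>) \<in> pcls U (ucls U x)"
  proof -
    \<comment> \<open>\<open>D\<close> has to dominate both \<open>C\<close> and
      \<open>1 / C\<close> for a two-sided comparison.\<close>
    define D where "D = max C (1 / C)"
    have "1 / C * C \<le> D * C" using C by (intro mult_right_mono) (auto simp: D_def)
    then have D: "D > 0" "C \<le> D" "1 \<le> D * C" using C by (auto simp: D_def less_max_iff_disj)
    then have "1 * \<bar>x i\<bar> \<le> (D * C) * \<bar>x i\<bar>" "C * \<bar>x i\<bar> \<le> D * \<bar>x i\<bar>" for i
      by (intro mult_right_mono; simp)+
    with D show ?thesis by (auto simp: mem_pcls_iff mult.assoc intro!: exI[of _ "\<lambda>i. C * \<bar>x i\<bar>"] exI[of _ D])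
  qed
  ultimately have "hless U (ucls U (\<lambda>i. C * \<bar>x i\<bar>)) (ucls U (\<lambda>i. \<bar>y i\<bar>))"
    using abs_mem_pcls[of y] by (auto simp: pless_def)
  then show "\<forall>\<^sub>F i in U. C * \<bar>x i\<bar> < \<bar>y i\<bar>" by (simp add: urel_ucls)
next
  assume *: "\<forall>C>0. \<forall>\<^sub>F i in U. C * \<bar>x i\<bar> < \<bar>y i\<bar>"
  show "pless U (pcls U (ucls U x)) (pcls U (ucls U y))"
    unfolding pless_def
  proof (intro ballI)
    fix Z W assume "Z \<in> pcls U (ucls U x)" "W \<in> pcls U (ucls U y)"
    then obtain z w C D where Z: "Z = ucls U z" "W = ucls U w" and CD: "C > 0" "D > 0"
      and ev: "\<forall>\<^sub>F i in U. \<bar>x i\<bar> \<le> C * z i \<and> z i \<le> C * \<bar>x i\<bar>"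
        "\<forall>\<^sub>F i in U. \<bar>y i\<bar> \<le> D * w i \<and> w i \<le> D * \<bar>y i\<bar>"
      by (auto simp: mem_pcls_iff)
    have "\<forall>\<^sub>F i in U. (D * C) * \<bar>x i\<bar> < \<bar>y i\<bar>" using * CD by simp
    with ev have "\<forall>\<^sub>F i in U. z i < w i"
    proof eventually_elim
      case (elim i)
      have "D * z i \<le> D * (C * \<bar>x i\<bar>)" using elim CD by simp
      also have "\<dots> < D * w i" using elim by (simp add: mult_ac)
      finally show ?case using CD by simp
    qed
    then show "hless U Z W" by (simp add: Z urel_ucls)
  qed
qed

text \<open>Totality is the point: if the strict order fails, some multiple of \<open>x\<close>
  eventually dominates \<open>y\<close> in absolute value by the ultrafilter property, and with the
  assumed bound the two classes coincide.\<close>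

lemma ple_pcls_iff:
  "ple U (pcls U (ucls U x)) (pcls U (ucls U y)) \<longleftrightarrow> (\<exists>C>0. \<forall>\<^sub>F i in U. \<bar>x i\<bar> \<le> C * \<bar>y i\<bar>)"
proof
  assume "ple U (pcls U (ucls U x)) (pcls U (ucls U y))"
  then consider "pless U (pcls U (ucls U x)) (pcls U (ucls U y))"
    | "pcls U (ucls U x) = pcls U (ucls U y)" by (auto simp: ple_def)
  then show "\<exists>C>0. \<forall>\<^sub>F i in U. \<bar>x i\<bar> \<le> C * \<bar>y i\<bar>"
  proof cases
    case 1
    then have "\<forall>\<^sub>F i in U. 1 * \<bar>x i\<bar> < \<bar>y i\<bar>" unfolding pless_pcls_iff by (metis zero_less_one)
    then have "\<forall>\<^sub>F i in U. \<bar>x i\<bar> \<le> 1 * \<bar>y i\<bar>" by eventually_elim simp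
    then show ?thesis using zero_less_one by blast
  next
    case 2
    then show ?thesis unfolding pcls_eq_iff by (auto elim: eventually_mono)
  qed
next
  assume "\<exists>C>0. \<forall>\<^sub>F i in U. \<bar>x i\<bar> \<le> C * \<bar>y i\<bar>"
  then obtain C where C: "C > 0" "\<forall>\<^sub>F i in U. \<bar>x i\<bar> \<le> C * \<bar>y i\<bar>" by blast
  show "ple U (pcls U (ucls U x)) (pcls U (ucls U y))"
  proof (cases "pless U (pcls U (ucls U x)) (pcls U (ucls U y))")
    case False
    then obtain D where D: "D > 0" "\<forall>\<^sub>F i in U. \<not> D * \<bar>x i\<bar> < \<bar>y i\<bar>"
      by (auto simp: pless_pcls_iff ultra_not_iff)
    from C(2) D(2) have "\<forall>\<^sub>F i in U. \<bar>x i\<bar> \<le> max C D * \<bar>y i\<bar> \<and> \<bar>y i\<bar> \<le> max C D * \<bar>x i\<bar>"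
    proof eventually_elim
      case (elim i)
      have "C * \<bar>y i\<bar> \<le> max C D * \<bar>y i\<bar>" "D * \<bar>x i\<bar> \<le> max C D * \<bar>x i\<bar>"
        by (intro mult_right_mono; simp)+
      with elim show ?case by linarith
    qed
    moreover have "max C D > 0" using C by simp
    ultimately have "pcls U (ucls U x) = pcls U (ucls U y)" unfolding pcls_eq_iff by blast
    then show ?thesis by (simp add: ple_def)
  qed (simp add: ple_def)
qed

text \<open>The union in \<open>pmult\<close> is over products of representatives whose classes all
  agree, and it is nonempty, so it collapses to that class.\<close>

lemma pmult_pcls: "pmult U (pcls U (ucls U x)) (pcls U (ucls U y)) = pcls U (ucls U (\<lambda>i. x i * y i))"
proof -
  have eq: "pcls U (Z \<otimes>\<^bsub>hyperreal U\<^esub> W) = pcls U (ucls U (\<lambda>i. x i * y i))"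
    if Z: "Z \<in> pcls U (ucls U x)" and W: "W \<in> pcls U (ucls U y)" for Z W
  proof -
    obtain z w where zw: "Z = ucls U z" "W = ucls U w" using Z W by (auto simp: mem_pcls_iff)
    obtain C D where CD: "C > 0" "D > 0"
      and ev: "\<forall>\<^sub>F i in U. \<bar>z i\<bar> \<le> C * \<bar>x i\<bar> \<and> \<bar>x i\<bar> \<le> C * \<bar>z i\<bar>"
        "\<forall>\<^sub>F i in U. \<bar>w i\<bar> \<le> D * \<bar>y i\<bar> \<and> \<bar>y i\<bar> \<le> D * \<bar>w i\<bar>"
      using pcls_eqI[OF Z zw(1)] pcls_eqI[OF W zw(2)] by (auto simp: pcls_eq_iff)
    from ev have "\<forall>\<^sub>F i in U. \<bar>z i * w i\<bar> \<le> (C * D) * \<bar>x i * y i\<bar> \<and> \<bar>x i * y i\<bar> \<le> (C * D) * \<bar>z i * w i\<bar>"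
    proof eventually_elim
      case (elim i)
      then have "\<bar>z i\<bar> * \<bar>w i\<bar> \<le> (C * \<bar>x i\<bar>) * (D * \<bar>y i\<bar>)" "\<bar>x i\<bar> * \<bar>y i\<bar> \<le> (C * \<bar>z i\<bar>) * (D * \<bar>w i\<bar>)"
        using CD by (auto intro!: mult_mono)
      then show ?case by (simp add: abs_mult mult_ac)
    qed
    moreover have "C * D > 0" using CD by simp
    ultimately show ?thesis unfolding zw hyperreal_mult pcls_eq_iff by blast
  qed
  then show ?thesis
    unfolding pmult_def using abs_mem_pcls[of x] abs_mem_pcls[of y] by (auto simp: eq)
qed

text \<open>Powers with exponent \<open>t \<ge> 0\<close> are monotone, so a comparison with
  constant \<open>C\<close> becomes one with constant \<open>C powr t\<close>, and the union in
  \<open>ppow\<close> collapses.\<close>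

lemma ppow_pcls:
  assumes "t \<ge> 0"
  shows "ppow U (pcls U (ucls U x)) t = pcls U (ucls U (\<lambda>i. \<bar>x i\<bar> powr t))"
proof -
  have eq: "pcls U (ulift1 U (\<lambda>x. x powr t) Z) = pcls U (ucls U (\<lambda>i. \<bar>x i\<bar> powr t))"
    if Z: "Z \<in> pcls U (ucls U x)" for Z
  proof -
    obtain z C where zw: "Z = ucls U z" and C: "C > 0"
      and ev: "\<forall>\<^sub>F i in U. \<bar>x i\<bar> \<le> C * z i \<and> z i \<le> C * \<bar>x i\<bar>"
      using Z unfolding mem_pcls_iff by blast
    from ev have "\<forall>\<^sub>F i in U. \<bar>z i powr t\<bar> \<le> (C powr t) * \<bar>\<bar>x i\<bar> powr t\<bar> \<and> \<bar>\<bar>x i\<bar> powr t\<bar> \<le> (C powr t) * \<bar>z i powr t\<bar>"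
    proof eventually_elim
      case (elim i)
      have "0 \<le> C * z i" using elim abs_ge_zero[of "x i"] by linarith
      then have z: "0 \<le> z i" using C by (simp add: zero_le_mult_iff)
      then have "z i powr t \<le> (C * \<bar>x i\<bar>) powr t" "\<bar>x i\<bar> powr t \<le> (C * z i) powr t"
        using elim assms by (auto intro!: powr_mono2)
      then show ?case using z C by (simp add: powr_mult)
    qed
    moreover have "C powr t > 0" using C by simp
    ultimately show ?thesis unfolding zw ulift1_ucls pcls_eq_iff by blast
  qed
  then show ?thesis
    unfolding ppow_def using abs_mem_pcls[of x] by (auto simp: eq)
qed

text \<open>The semiring sum distinguishes cases on classes, the maximum on indices. If
  \<open>x\<close> is bounded by a multiple of \<open>y\<close>, the maximum is comparable with
  \<open>y\<close>; if not, it eventually equals the absolute value of \<open>x\<close>.\<close>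

lemma padd_pcls:
  assumes M: "\<And>i. M i = max (\<bar>x i\<bar>) (\<bar>y i\<bar>)"
  shows "padd U (pcls U (ucls U x)) (pcls U (ucls U y)) = pcls U (ucls U M)"
proof (cases "ple U (pcls U (ucls U x)) (pcls U (ucls U y))")
  case True
  then obtain C where C: "C > 0" "\<forall>\<^sub>F i in U. \<bar>x i\<bar> \<le> C * \<bar>y i\<bar>" by (auto simp: ple_pcls_iff)
  from C(2) have "\<forall>\<^sub>F i in U. \<bar>y i\<bar> \<le> max 1 C * \<bar>M i\<bar> \<and> \<bar>M i\<bar> \<le> max 1 C * \<bar>y i\<bar>"
  proof eventually_elim
    case (elim i)
    have "C * \<bar>y i\<bar> \<le> max 1 C * \<bar>y i\<bar>" "1 * \<bar>y i\<bar> \<le> max 1 C * \<bar>y i\<bar>"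
      "1 * \<bar>M i\<bar> \<le> max 1 C * \<bar>M i\<bar>"
      by (intro mult_right_mono; simp)+
    with elim M[of i] show ?case by linarith
  qed
  moreover have "max 1 C > 0" by simp
  ultimately have "pcls U (ucls U y) = pcls U (ucls U M)"
    unfolding pcls_eq_iff by blast
  then show ?thesis using True by (simp add: padd_def)
next
  case False
  then have "\<not> (\<forall>\<^sub>F i in U. \<bar>x i\<bar> \<le> 1 * \<bar>y i\<bar>)" unfolding ple_pcls_iff using zero_less_one by blast
  then have "\<forall>\<^sub>F i in U. \<not> \<bar>x i\<bar> \<le> 1 * \<bar>y i\<bar>" by (simp only: ultra_not_iff)
  then have "\<forall>\<^sub>F i in U. \<bar>x i\<bar> \<le> 1 * \<bar>M i\<bar> \<and> \<bar>M i\<bar> \<le> 1 * \<bar>x i\<bar>"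
    by eventually_elim (auto simp: M)
  then have "pcls U (ucls U x) = pcls U (ucls U M)"
    unfolding pcls_eq_iff by (intro exI[of _ 1]) simp
  then show ?thesis using False by (simp add: padd_def)
qed

lemma PP_eps_representative:
  assumes "\<mu> \<in> PP_eps U"
  obtains x where "\<mu> = pcls U (ucls U x)" "\<And>i. 0 < x i" "\<forall>d>0. \<forall>\<^sub>F i in U. x i < d"
proof -
  obtain y where \<mu>: "\<mu> = pcls U (ucls U y)" and small: "\<And>d. 0 < d \<Longrightarrow> \<forall>\<^sub>F i in U. \<bar>y i\<bar> < d"
    and pos: "\<forall>\<^sub>F i in U. 0 < y i"
    using assms by (auto simp: PP_eps_def hinfinitesimal_def hconst_def urel_ucls ulift1_ucls)
  \<comment> \<open>Values on a set negligible for the ultrafilter are replaced by 1, so that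
    positivity holds at every index and not only eventually.\<close>
  define x where "x i = (if 0 < y i then y i else 1)" for i
  have "ucls U x = ucls U y" using pos by (auto simp: ucls_eq_iff x_def elim: eventually_mono)
  moreover have "\<forall>\<^sub>F i in U. x i < d" if "0 < d" for d
    using small[OF that] pos by eventually_elim (simp add: x_def)
  ultimately show ?thesis using \<mu> by (intro that[of x]) (auto simp: x_def)
qed

lemma hvec_max_uvec: "hvec_max U (uvec U v) = ucls U (\<lambda>i. infnorm (v i))"
  unfolding hvec_max_def
proof (rule the_equality)
  have "\<forall>\<^sub>F i in U. \<exists>j. infnorm (v i) = \<bar>v i $ j\<bar>" by (intro always_eventually allI) (meson infnorm_attained_cart)
  \<comment> \<open>The maximizing coordinate may vary with the index; finiteness lets the
    ultrafilter fix one.\<close>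
  then obtain j where "\<forall>\<^sub>F i in U. infnorm (v i) = \<bar>v i $ j\<bar>" by (rule ultra_finite_choice)
  then have "ucls U (\<lambda>i. infnorm (v i)) \<in> range (\<lambda>j. habs U (uvec U v $ j))"
    by (auto simp: ulift1_ucls ucls_eq_iff)
  then show "ucls U (\<lambda>i. infnorm (v i)) \<in> range (\<lambda>j. habs U (uvec U v $ j)) \<and>
      (\<forall>j. hle U (habs U (uvec U v $ j)) (ucls U (\<lambda>i. infnorm (v i))))"
    by (simp add: ulift1_ucls urel_ucls component_le_infnorm_cart)
next
  fix M assume M: "M \<in> range (\<lambda>j. habs U (uvec U v $ j)) \<and> (\<forall>j. hle U (habs U (uvec U v $ j)) M)"
  then obtain j where j: "M = ucls U (\<lambda>i. \<bar>v i $ j\<bar>)" by (auto simp: ulift1_ucls)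
  have "\<forall>\<^sub>F i in U. \<forall>k. \<bar>v i $ k\<bar> \<le> \<bar>v i $ j\<bar>"
    using M by (simp add: j ulift1_ucls urel_ucls eventually_all_finite)
  then have "\<forall>\<^sub>F i in U. \<bar>v i $ j\<bar> = infnorm (v i)"
  proof eventually_elim
    case (elim i)
    obtain k where "infnorm (v i) = \<bar>v i $ k\<bar>" by (rule infnorm_attained_cart)
    with elim component_le_infnorm_cart[of "v i" j] show ?case by (simp add: order_antisym)
  qed
  then show "M = ucls U (\<lambda>i. infnorm (v i))" by (simp add: j ucls_eq_iff)
qed

end

section \<open>Diophantine groups in terms of representing sequences\<close>

text \<open>Here \<open>v\<close> represents the vector and \<open>p\<close> its
  \<open>perp\<close>. The sequences \<open>a\<close> and \<open>c\<close> stand for the classes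
  after the roots have been taken, so no exponents occur. Strict comparison of classes quantifies
  over all constants, weak comparison over some constant.\<close>

definition seq_dioph ::
  "nat filter \<Rightarrow> (nat \<Rightarrow> real) \<Rightarrow> (nat \<Rightarrow> real) \<Rightarrow> (nat \<Rightarrow> real) \<Rightarrow> real ^ 's ^ 'r
     \<Rightarrow> (nat \<Rightarrow> real ^ 's) \<Rightarrow> (nat \<Rightarrow> real ^ 'r) \<Rightarrow> bool" where
  "seq_dioph U a b c \<Theta> v p \<longleftrightarrow>
     (\<forall>i j. v i $ j \<in> \<int>) \<and> (\<forall>i j. p i $ j \<in> \<int>) \<and>
     (\<forall>d>0. \<forall>\<^sub>F i in U. infnorm (\<Theta> *v v i - p i) < d) \<and>
     (\<forall>C>0. \<forall>\<^sub>F i in U. C * (infnorm (v i) * a i) < b i) \<and>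
     (\<exists>C>0. \<forall>\<^sub>F i in U. infnorm (\<Theta> *v v i - p i) \<le> C * c i)"

lemma mem_hint_vecs_iff: "N \<in> hint_vecs U \<longleftrightarrow> (\<exists>v. N = uvec U v \<and> (\<forall>i j. v i $ j \<in> \<int>))"
proof
  assume "N \<in> hint_vecs U"
  then have "\<forall>j. \<exists>x. N $ j = ucls U x \<and> (\<forall>i. x i \<in> \<int>)"
    by (auto simp: hint_vecs_def hyperints_def ultrapower_def)
  then obtain x where x: "\<And>j. N $ j = ucls U (x j)" "\<And>j i. x j i \<in> \<int>" by metis
  then show "\<exists>v. N = uvec U v \<and> (\<forall>i j. v i $ j \<in> \<int>)"
    by (intro exI[of _ "\<lambda>i. \<chi> j. x j i"]) (simp add: vec_eq_iff)
qed (auto simp: hint_vecs_def hyperints_def ultrapower_def)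

context
  fixes U :: "nat filter"
  assumes nu: "nonprincipal_ultrafilter U"
begin

lemma uvec_infinitesimal_iff:
  "(\<forall>j. uvec U v $ j \<in> hinfinitesimal U) \<longleftrightarrow> (\<forall>d>0. \<forall>\<^sub>F i in U. infnorm (v i) < d)"
proof -
  have "infnorm (v i) < d \<longleftrightarrow> (\<forall>j. \<bar>v i $ j\<bar> < d)" for i d
    by (metis component_le_infnorm_cart infnorm_attained_cart order_le_less_trans)
  then have "(\<forall>\<^sub>F i in U. infnorm (v i) < d) \<longleftrightarrow> (\<forall>j. \<forall>\<^sub>F i in U. \<bar>v i $ j\<bar> < d)" for d
    using eventually_ball_finite_distrib[of UNIV "\<lambda>i j. \<bar>v i $ j\<bar> < d" U] by simp
  then show ?thesis
    by (auto simp: hinfinitesimal_def hconst_def urel_ucls ulift1_ucls)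
qed

lemma is_perp_uvec_iff:
  "is_perp U \<Theta> (uvec U v) P \<longleftrightarrow>
     (\<exists>p. P = uvec U p \<and> (\<forall>i j. p i $ j \<in> \<int>) \<and>
          (\<forall>d>0. \<forall>\<^sub>F i in U. infnorm (\<Theta> *v v i - p i) < d))"
proof -
  have "(\<forall>j. hvec_diff U (hmat_vec U \<Theta> (uvec U v)) (uvec U p) $ j \<in> hinfinitesimal U) \<longleftrightarrow>
      (\<forall>d>0. \<forall>\<^sub>F i in U. infnorm (\<Theta> *v v i - p i) < d)" for p
    unfolding hmat_vec_uvec hvec_diff_uvec by (rule uvec_infinitesimal_iff)
  then show ?thesis unfolding is_perp_def mem_hint_vecs_iff by blast
qed

lemma perp_unique:
  assumes "is_perp U \<Theta> (uvec U v) P" "is_perp U \<Theta> (uvec U v) Q"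
  shows "P = Q"
proof -
  obtain p q where pq: "P = uvec U p" "Q = uvec U q" "\<And>i j. p i $ j \<in> \<int>" "\<And>i j. q i $ j \<in> \<int>"
    and p: "\<forall>d>0. \<forall>\<^sub>F i in U. infnorm (\<Theta> *v v i - p i) < d"
    and q: "\<forall>d>0. \<forall>\<^sub>F i in U. infnorm (\<Theta> *v v i - q i) < d"
    using assms unfolding is_perp_uvec_iff by blast
  \<comment> \<open>Two integer vectors within 1/2 of the same point differ by less than 1.\<close>
  have "(0::real) < 1/2" by simp
  from p[rule_format, OF this] q[rule_format, OF this] have "\<forall>\<^sub>F i in U. p i = q i"
  proof eventually_elim
    case (elim i)
    have "infnorm (p i - q i) < 1"
      using infnorm_diff_le[of "\<Theta> *v v i - q i" "\<Theta> *v v i - p i"] elim by simp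
    then have "p i - q i = 0" using pq by (intro Ints_vec_zero) auto
    then show ?case by simp
  qed
  then show ?thesis by (auto simp: pq vec_eq_iff ucls_eq_iff elim: eventually_mono)
qed

lemma err_uvec:
  assumes "is_perp U \<Theta> (uvec U v) (uvec U p)"
  shows "err U \<Theta> (uvec U v) = uvec U (\<lambda>i. \<Theta> *v v i - p i)"
proof -
  have "perp U \<Theta> (uvec U v) = uvec U p"
    unfolding perp_def using assms by (intro the_equality) (auto intro: perp_unique)
  then show ?thesis by (simp add: err_def hmat_vec_uvec hvec_diff_uvec)
qed

lemma mem_fdioph_group_iff:
  fixes \<Theta> :: "real ^ 's ^ 'r"
  assumes "\<And>i. 0 < a i" "\<And>i. 0 < b i" "\<And>i. 0 < c i"
  shows "N \<in> fdioph_group U (pcls U (ucls U a)) (pcls U (ucls U b)) (pcls U (ucls U c)) \<Theta> \<longleftrightarrow>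
    (\<exists>v p. N = uvec U v \<and>
       seq_dioph U (\<lambda>i. a i powr (1 / CARD('s))) b (\<lambda>i. c i powr (1 / CARD('r))) \<Theta> v p)"
    (is "?L \<longleftrightarrow> ?R")
proof -
  have pos: "\<bar>a i\<bar> = a i" "\<bar>b i\<bar> = b i" "\<bar>c i\<bar> = c i" for i
    using assms[of i] by simp_all
  have size: "pless U (pscale U (hvec_max U (uvec U v)) (ppow U (pcls U (ucls U a)) (1 / CARD('s))))
        (pcls U (ucls U b)) \<longleftrightarrow>
      (\<forall>C>0. \<forall>\<^sub>F i in U. C * (infnorm (v i) * a i powr (1 / CARD('s))) < b i)" for v :: "nat \<Rightarrow> real ^ 's"
    by (simp add: hvec_max_uvec[OF nu] pscale_def ppow_pcls[OF nu] pmult_pcls[OF nu] pless_pcls_iff[OF nu]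
        pos abs_mult infnorm_pos_le)
  \<comment> \<open>By uniqueness of the \<open>perp\<close>, the error may be computed from any
    \<open>p\<close> representing it.\<close>
  have error: "ple U (pcls U (hvec_max U (err U \<Theta> (uvec U v)))) (ppow U (pcls U (ucls U c)) (1 / CARD('r))) \<longleftrightarrow>
      (\<exists>C>0. \<forall>\<^sub>F i in U. infnorm (\<Theta> *v v i - p i) \<le> C * c i powr (1 / CARD('r)))"
    if "is_perp U \<Theta> (uvec U v) (uvec U p)" for v p
    by (simp add: err_uvec[OF that] hvec_max_uvec[OF nu] ppow_pcls[OF nu] ple_pcls_iff[OF nu]
        pos infnorm_pos_le)
  show ?thesis
  proof
    assume L: ?L
    then have "N \<in> hint_vecs U" by (simp add: fdioph_group_def dioph_group_def)
    then obtain v where v: "N = uvec U v" "\<And>i j. v i $ j \<in> \<int>" by (auto simp: mem_hint_vecs_iff)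
    from L obtain P where P: "is_perp U \<Theta> (uvec U v) P"
      by (auto simp: fdioph_group_def dioph_group_def v)
    then obtain p where p: "P = uvec U p" "\<And>i j. p i $ j \<in> \<int>"
      "\<forall>d>0. \<forall>\<^sub>F i in U. infnorm (\<Theta> *v v i - p i) < d"
      by (auto simp: is_perp_uvec_iff)
    from L size[of v] error[OF P[unfolded p]]
    show ?R unfolding v fdioph_group_def seq_dioph_def using p v by blast
  next
    assume ?R
    then obtain v p where N: "N = uvec U v"
      and s: "seq_dioph U (\<lambda>i. a i powr (1 / CARD('s))) b (\<lambda>i. c i powr (1 / CARD('r))) \<Theta> v p" by blast
    then have P: "is_perp U \<Theta> (uvec U v) (uvec U p)"
      unfolding is_perp_uvec_iff seq_dioph_def by blast
    moreover have "N \<in> hint_vecs U" using s N unfolding mem_hint_vecs_iff seq_dioph_def by blast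
    ultimately show ?L
      using s size[of v] error[OF P] unfolding fdioph_group_def dioph_group_def seq_dioph_def N by blast
  qed
qed

end

section \<open>Group structure and bilinearity on representatives\<close>

text \<open>Packages what \<open>comm_group_hvec_group\<close> needs beyond identities that hold
  index by index. It is stable under intersection, as the common target for the Kronecker sum and
  difference requires.\<close>

definition uvec_subgroup :: "nat filter \<Rightarrow> (real ultra ^ 'k) set \<Rightarrow> bool" where
  "uvec_subgroup U A \<longleftrightarrow>
     A \<subseteq> range (uvec U) \<and> uvec U (\<lambda>_. 0) \<in> A \<and>
     (\<forall>M\<in>A. \<forall>N\<in>A. hvec_add U M N \<in> A) \<and>
     (\<forall>v. uvec U v \<in> A \<longrightarrow> uvec U (\<lambda>i. - v i) \<in> A)"

lemma uvec_subgroup_Int: "uvec_subgroup U A \<Longrightarrow> uvec_subgroup U B \<Longrightarrow> uvec_subgroup U (A \<inter> B)"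
  unfolding uvec_subgroup_def by blast

lemma comm_group_hvec_group:
  assumes "uvec_subgroup U A"
  shows "comm_group (hvec_group U A)"
proof (rule comm_groupI)
  have ex: "\<exists>v. N = uvec U v" if "N \<in> A" for N using that assms by (auto simp: uvec_subgroup_def)
  fix L M N assume "L \<in> carrier (hvec_group U A)" "M \<in> carrier (hvec_group U A)"
    "N \<in> carrier (hvec_group U A)"
  then obtain u v w where "L = uvec U u" "M = uvec U v" "N = uvec U w"
    using ex[of L] ex[of M] ex[of N] by (auto simp: hvec_group_def)
  then show "L \<otimes>\<^bsub>hvec_group U A\<^esub> M \<otimes>\<^bsub>hvec_group U A\<^esub> N
      = L \<otimes>\<^bsub>hvec_group U A\<^esub> (M \<otimes>\<^bsub>hvec_group U A\<^esub> N)"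
    "L \<otimes>\<^bsub>hvec_group U A\<^esub> M = M \<otimes>\<^bsub>hvec_group U A\<^esub> L"
    "\<one>\<^bsub>hvec_group U A\<^esub> \<otimes>\<^bsub>hvec_group U A\<^esub> L = L"
    by (simp_all add: hvec_group_def hvec_add_uvec hvec_zero add_ac)
next
  fix N assume N: "N \<in> carrier (hvec_group U A)"
  then obtain v where v: "N = uvec U v" using assms by (auto simp: uvec_subgroup_def hvec_group_def)
  with N assms have "uvec U (\<lambda>i. - v i) \<in> A" by (auto simp: uvec_subgroup_def hvec_group_def)
  then show "\<exists>M\<in>carrier (hvec_group U A). M \<otimes>\<^bsub>hvec_group U A\<^esub> N = \<one>\<^bsub>hvec_group U A\<^esub>"
    by (intro bexI[of _ "uvec U (\<lambda>i. - v i)"]) (simp_all add: hvec_group_def v hvec_add_uvec hvec_zero)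
qed (use assms in \<open>auto simp: uvec_subgroup_def hvec_group_def hvec_zero\<close>)

lemma seq_dioph_zero:
  assumes "\<And>i. 0 < b i" "\<And>i. 0 < c i"
  shows "seq_dioph U a b c \<Theta> (\<lambda>_. 0) (\<lambda>_. 0)"
  using assms by (auto simp: seq_dioph_def infnorm_0 less_imp_le intro!: exI[of _ "1::real"])

lemma seq_dioph_minus:
  assumes "seq_dioph U a b c \<Theta> v p"
  shows "seq_dioph U a b c \<Theta> (\<lambda>i. - v i) (\<lambda>i. - p i)"
proof -
  have "\<Theta> *v (- v i) - - p i = - (\<Theta> *v v i - p i)" for i
    by (simp add: vec_eq_iff matrix_vector_mult_def sum_negf)
  then have "infnorm (\<Theta> *v (- v i) - - p i) = infnorm (\<Theta> *v v i - p i)" for i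
    by (metis infnorm_neg)
  with assms show ?thesis by (auto simp: seq_dioph_def infnorm_neg)
qed

lemma seq_dioph_add:
  assumes "seq_dioph U a b c \<Theta> v p" "seq_dioph U a b c \<Theta> w q" "\<And>i. 0 < a i" "\<And>i. 0 < c i"
  shows "seq_dioph U a b c \<Theta> (\<lambda>i. v i + w i) (\<lambda>i. p i + q i)"
proof -
  have err: "infnorm (\<Theta> *v (v i + w i) - (p i + q i))
      \<le> infnorm (\<Theta> *v v i - p i) + infnorm (\<Theta> *v w i - q i)" for i
    using infnorm_triangle[of "\<Theta> *v v i - p i" "\<Theta> *v w i - q i"]
    by (simp add: matrix_vector_right_distrib algebra_simps)
  have inf: "\<forall>\<^sub>F i in U. infnorm (\<Theta> *v (v i + w i) - (p i + q i)) < d" if "d > 0" for d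
  proof -
    have "\<forall>\<^sub>F i in U. infnorm (\<Theta> *v v i - p i) < d / 2" "\<forall>\<^sub>F i in U. infnorm (\<Theta> *v w i - q i) < d / 2"
      using assms(1,2) that unfolding seq_dioph_def by (meson half_gt_zero)+
    then show ?thesis
    proof eventually_elim
      case (elim i)
      with err[of i] show ?case by linarith
    qed
  qed
  have size: "\<forall>\<^sub>F i in U. C * (infnorm (v i + w i) * a i) < b i" if "C > 0" for C
  proof -
    \<comment> \<open>The size condition holds for every constant, so the factor 2 from the triangle
      inequality is absorbed in advance.\<close>
    have "\<forall>\<^sub>F i in U. 2 * C * (infnorm (v i) * a i) < b i" "\<forall>\<^sub>F i in U. 2 * C * (infnorm (w i) * a i) < b i"
      using assms(1,2) that unfolding seq_dioph_def by (metis mult_pos_pos zero_less_numeral)+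
    then show ?thesis
    proof eventually_elim
      case (elim i)
      have "C * (infnorm (v i + w i) * a i) \<le> C * ((infnorm (v i) + infnorm (w i)) * a i)"
        using that assms(3)[of i] by (intro mult_left_mono mult_right_mono infnorm_triangle) auto
      also have "\<dots> < b i" using elim by (simp add: algebra_simps)
      finally show ?case .
    qed
  qed
  have "\<exists>C>0. \<forall>\<^sub>F i in U. infnorm (\<Theta> *v (v i + w i) - (p i + q i)) \<le> C * c i"
  proof -
    obtain C D where CD: "C > 0" "D > 0" "\<forall>\<^sub>F i in U. infnorm (\<Theta> *v v i - p i) \<le> C * c i"
      "\<forall>\<^sub>F i in U. infnorm (\<Theta> *v w i - q i) \<le> D * c i"
      using assms(1,2) by (auto simp: seq_dioph_def)
    from CD(3,4) have "\<forall>\<^sub>F i in U. infnorm (\<Theta> *v (v i + w i) - (p i + q i)) \<le> (C + D) * c i"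
    proof eventually_elim
      case (elim i)
      with err[of i] show ?case by (simp add: algebra_simps)
    qed
    moreover have "C + D > 0" using CD by simp
    ultimately show ?thesis by blast
  qed
  with inf size assms(1,2) show ?thesis by (auto simp: seq_dioph_def)
qed

text \<open>An error below 1 is at most the norm of \<open>v\<close> when \<open>v\<close> is a
  nonzero integer vector; when \<open>v\<close> vanishes, \<open>p\<close> has norm below 1 and
  vanishes as well.\<close>

lemma perp_le_infnorm:
  fixes A :: "real ^ 's ^ 'r"
  assumes "seq_dioph U a b c A v p"
  obtains K where "K > 0" "\<forall>\<^sub>F i in U. infnorm (p i) \<le> K * infnorm (v i)"
proof -
  obtain K where K: "K > 0" "\<And>x. infnorm (A *v x) \<le> K * infnorm x"
    using infnorm_matrix_vector_bound[of A] by blast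
  have int: "\<And>i j. v i $ j \<in> \<int>" "\<And>i j. p i $ j \<in> \<int>"
    and "\<forall>\<^sub>F i in U. infnorm (A *v v i - p i) < 1"
    using assms by (auto simp: seq_dioph_def)
  \<comment> \<open>\<open>K\<close> accounts for the matrix and the added 1 for the error.\<close>
  from this(3) have "\<forall>\<^sub>F i in U. infnorm (p i) \<le> (K + 1) * infnorm (v i)"
  proof eventually_elim
    case (elim i)
    show ?case
    proof (cases "v i = 0")
      case True
      with elim have "infnorm (p i) < 1" by (simp add: infnorm_neg)
      then have "p i = 0" using int by (intro Ints_vec_zero)
      with True show ?thesis by (simp add: infnorm_0)
    next
      case False
      then have "infnorm (v i) \<ge> 1" using Ints_vec_zero[of "v i"] int by force
      with K(2)[of "v i"] elim infnorm_diff_le[of "A *v v i" "A *v v i - p i"]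
      show ?thesis by (simp add: algebra_simps)
    qed
  qed
  then show ?thesis using K(1) by (intro that[of "K + 1"]) auto
qed

lemma uvec_subgroup_seq_dioph:
  assumes "\<And>i. 0 < a i" "\<And>i. 0 < b i" "\<And>i. 0 < c i"
  shows "uvec_subgroup U {N. \<exists>v p. N = uvec U v \<and> seq_dioph U a b c \<Theta> v p}" (is "uvec_subgroup U ?A")
  unfolding uvec_subgroup_def
proof (intro conjI ballI allI impI)
  show "uvec U (\<lambda>_. 0) \<in> ?A" using seq_dioph_zero[of b c] assms by blast
next
  fix M N assume "M \<in> ?A" "N \<in> ?A"
  then obtain v p w q where "M = uvec U v" "N = uvec U w" "seq_dioph U a b c \<Theta> v p" "seq_dioph U a b c \<Theta> w q"
    by blast
  then show "hvec_add U M N \<in> ?A"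
    using seq_dioph_add[of U a b c \<Theta> v p w q] assms by (auto simp: hvec_add_uvec)
next
  fix v assume "uvec U v \<in> ?A"
  then obtain w p where eq: "uvec U v = uvec U w" and w: "seq_dioph U a b c \<Theta> w p" by blast
  \<comment> \<open>The representatives \<open>v\<close> and \<open>w\<close> agree only eventually,
    and so do their negatives.\<close>
  from eq have "uvec U (\<lambda>i. - v i) = uvec U (\<lambda>i. - w i)" by (simp add: vec_eq_iff ucls_eq_iff)
  with seq_dioph_minus[OF w] show "uvec U (\<lambda>i. - v i) \<in> ?A" by blast
qed auto

text \<open>Distributivity holds at each index, so the product is additive in both variables; the
  real content is the containment \<open>mem\<close>.\<close>

lemma bilinear_pairing_hvec_kron:
  assumes "uvec_subgroup U A" "uvec_subgroup U B" "uvec_subgroup U C"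
    and mem: "\<And>M N. M \<in> A \<Longrightarrow> N \<in> B \<Longrightarrow> hvec_kron U M N \<in> C"
  shows "bilinear_pairing (hvec_kron U) (hvec_group U A) (hvec_group U B) (hvec_group U C)"
proof -
  have exA: "\<exists>v. N = uvec U v" if "N \<in> A" for N using that assms(1) by (auto simp: uvec_subgroup_def)
  have exB: "\<exists>v. N = uvec U v" if "N \<in> B" for N using that assms(2) by (auto simp: uvec_subgroup_def)
  have "hvec_kron U (hvec_add U M M') N = hvec_add U (hvec_kron U M N) (hvec_kron U M' N)"
    if "M \<in> A" "M' \<in> A" "N \<in> B" for M M' N
    using exA[OF that(1)] exA[OF that(2)] exB[OF that(3)]
    by (auto simp: hvec_add_uvec hvec_kron_uvec vkron_distribs)
  moreover have "hvec_kron U M (hvec_add U N N') = hvec_add U (hvec_kron U M N) (hvec_kron U M N')"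
    if "M \<in> A" "N \<in> B" "N' \<in> B" for M N N'
    using exA[OF that(1)] exB[OF that(2)] exB[OF that(3)]
    by (auto simp: hvec_add_uvec hvec_kron_uvec vkron_distribs)
  ultimately show ?thesis
    using assms(1-3)[THEN comm_group_hvec_group] mem
    by (auto simp: bilinear_pairing_def hom_def hvec_group_def)
qed

section \<open>Error estimates for Kronecker products, sums and differences\<close>

context
  fixes U :: "nat filter" and m n b k :: "nat \<Rightarrow> real"
  assumes nu: "nonprincipal_ultrafilter U"
    and pos: "\<And>i. 0 < m i" "\<And>i. 0 < n i" "\<And>i. 0 < b i" "\<And>i. 0 < k i"
    and small: "\<forall>d>0. \<forall>\<^sub>F i in U. b i < d" "\<forall>d>0. \<forall>\<^sub>F i in U. k i < d"
begin

text \<open>The part common to all three targets, with \<open>m\<close>, \<open>n\<close>,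
  \<open>b\<close>, \<open>k\<close> representing \<mu>, \<nu>, \<iota>, \<kappa>. Sizes multiply
  because the maximum norm is submultiplicative for Kronecker products. What remains for each matrix
  is an integral \<open>P\<close> with error at most twice the maximum of \<open>b\<close> and
  \<open>k\<close>.\<close>

lemma seq_dioph_targetI:
  fixes \<Theta> :: "real ^ ('t::finite \<times> 't2::finite) ^ 'r" and \<Theta>\<^sub>1 :: "real ^ 't ^ 'q" and \<Theta>\<^sub>2 :: "real ^ 't2 ^ 'q2"
  assumes v: "seq_dioph U m b n \<Theta>\<^sub>1 v p" and w: "seq_dioph U n k m \<Theta>\<^sub>2 w q"
    and int: "\<And>i j. P i $ j \<in> \<int>"
    and err: "\<forall>\<^sub>F i in U. infnorm (\<Theta> *v vkron (v i) (w i) - P i) \<le> 2 * max (b i) (k i)"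
  shows "seq_dioph U (\<lambda>i. m i * n i) (\<lambda>i. b i * k i) (\<lambda>i. max (b i) (k i) powr (1 / CARD('r))) \<Theta>
    (\<lambda>i. vkron (v i) (w i)) P"
  unfolding seq_dioph_def
proof (intro conjI allI impI)
  show "vkron (v i) (w i) $ j \<in> \<int>" for i j using v w by (auto simp: seq_dioph_def vkron_def)
  show "P i $ j \<in> \<int>" for i j by (rule int)
next
  fix d :: real assume "d > 0"
  then have "d / 2 > 0" by simp
  from err small(1)[rule_format, OF this] small(2)[rule_format, OF this]
  show "\<forall>\<^sub>F i in U. infnorm (\<Theta> *v vkron (v i) (w i) - P i) < d"
    by eventually_elim (auto simp: max_def split: if_splits)
next
  fix C :: real assume C: "C > 0"
  \<comment> \<open>The arbitrary constant is charged to the first factor; the second is used with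
    constant 1.\<close>
  have "\<forall>\<^sub>F i in U. C * (infnorm (v i) * m i) < b i" "\<forall>\<^sub>F i in U. 1 * (infnorm (w i) * n i) < k i"
    using v w C unfolding seq_dioph_def by (blast intro: zero_less_one)+
  then show "\<forall>\<^sub>F i in U. C * (infnorm (vkron (v i) (w i)) * (m i * n i)) < b i * k i"
  proof eventually_elim
    case (elim i)
    have "C * (infnorm (vkron (v i) (w i)) * (m i * n i))
        \<le> C * ((infnorm (v i) * infnorm (w i)) * (m i * n i))"
      using C pos[of i] by (intro mult_left_mono mult_right_mono infnorm_vkron) (auto simp: less_imp_le)
    also have "\<dots> = (C * (infnorm (v i) * m i)) * (infnorm (w i) * n i)" by (simp add: mult_ac)
    also have "\<dots> < b i * k i"
      using elim C pos[of i] by (intro mult_strict_mono) (auto simp: infnorm_pos_le less_imp_le)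
    finally show ?case .
  qed
next
  \<comment> \<open>Eventually the maximum lies below 1, where an exponent at most 1 can only
    enlarge it.\<close>
  from err small(1)[rule_format, OF zero_less_one] small(2)[rule_format, OF zero_less_one]
  have "\<forall>\<^sub>F i in U. infnorm (\<Theta> *v vkron (v i) (w i) - P i) \<le> 2 * max (b i) (k i) powr (1 / CARD('r))"
  proof eventually_elim
    case (elim i)
    have "max (b i) (k i) powr 1 \<le> max (b i) (k i) powr (1 / CARD('r))"
      using elim pos[of i] by (intro powr_mono') (auto simp: less_max_iff_disj)
    moreover have "max (b i) (k i) powr 1 = max (b i) (k i)" using pos[of i] by simp
    ultimately show ?case using elim by linarith
  qed
  then show "\<exists>C>0. \<forall>\<^sub>F i in U. infnorm (\<Theta> *v vkron (v i) (w i) - P i)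
      \<le> C * max (b i) (k i) powr (1 / CARD('r))"
    by (intro exI[of _ 2]) simp
qed

text \<open>Each error term of a Kronecker combination is a product of one factor's error with a vector
  that is at most a real multiple of the other factor.\<close>

lemma infnorm_vkron_errors:
  assumes v: "seq_dioph U m b n \<Theta> v p" and w: "seq_dioph U n k m \<Theta>' w q"
    and x: "K > 0" "\<forall>\<^sub>F i in U. infnorm (x i) \<le> K * infnorm (v i)"
    and y: "L > 0" "\<forall>\<^sub>F i in U. infnorm (y i) \<le> L * infnorm (w i)"
  shows "\<forall>\<^sub>F i in U. infnorm (vkron (\<Theta> *v v i - p i) (y i)) \<le> k i"
    and "\<forall>\<^sub>F i in U. infnorm (vkron (x i) (\<Theta>' *v w i - q i)) \<le> b i"
proof -
  obtain C D where C: "C > 0" "\<forall>\<^sub>F i in U. infnorm (\<Theta> *v v i - p i) \<le> C * n i"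
    and D: "D > 0" "\<forall>\<^sub>F i in U. infnorm (\<Theta>' *v w i - q i) \<le> D * m i"
    using v w by (auto simp: seq_dioph_def)
  \<comment> \<open>The size conditions hold for every constant, so these products of constants
    disappear from the final bounds. The decay of one factor supplies exactly the weight in the size
    condition of the other.\<close>
  have "C * L > 0" "K * D > 0" using C D x y by simp_all
  then have "\<forall>\<^sub>F i in U. (C * L) * (infnorm (w i) * n i) < k i"
    "\<forall>\<^sub>F i in U. (K * D) * (infnorm (v i) * m i) < b i"
    using v w unfolding seq_dioph_def by blast+
  note size = this
  from C(2) y(2) size(1) show "\<forall>\<^sub>F i in U. infnorm (vkron (\<Theta> *v v i - p i) (y i)) \<le> k i"
  proof eventually_elim
    case (elim i)
    have "infnorm (vkron (\<Theta> *v v i - p i) (y i)) \<le> infnorm (\<Theta> *v v i - p i) * infnorm (y i)"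
      by (rule infnorm_vkron)
    also have "\<dots> \<le> (C * n i) * (L * infnorm (w i))"
      using elim C(1) pos[of i] by (intro mult_mono) (auto simp: infnorm_pos_le less_imp_le)
    finally show ?case using elim by (simp add: mult_ac)
  qed
  from D(2) x(2) size(2) show "\<forall>\<^sub>F i in U. infnorm (vkron (x i) (\<Theta>' *v w i - q i)) \<le> b i"
  proof eventually_elim
    case (elim i)
    have "infnorm (vkron (x i) (\<Theta>' *v w i - q i)) \<le> infnorm (x i) * infnorm (\<Theta>' *v w i - q i)"
      by (rule infnorm_vkron)
    also have "\<dots> \<le> (K * infnorm (v i)) * (D * m i)"
      using elim x(1) pos[of i] by (intro mult_mono) (auto simp: infnorm_pos_le less_imp_le)
    finally show ?case using elim by (simp add: mult_ac)
  qed
qed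

lemma seq_dioph_kron:
  fixes \<Theta> :: "real ^ 's ^ 'r" and \<Theta>' :: "real ^ 's2 ^ 'r2"
  assumes v: "seq_dioph U m b n \<Theta> v p" and w: "seq_dioph U n k m \<Theta>' w q"
  shows "seq_dioph U (\<lambda>i. m i * n i) (\<lambda>i. b i * k i)
    (\<lambda>i. max (b i) (k i) powr (1 / CARD('r \<times> 'r2))) (kron \<Theta> \<Theta>')
    (\<lambda>i. vkron (v i) (w i)) (\<lambda>i. vkron (p i) (q i))"
proof (rule seq_dioph_targetI[OF v w])
  show "vkron (p i) (q i) $ j \<in> \<int>" for i j using v w by (auto simp: seq_dioph_def vkron_def)
  \<comment> \<open>In the split error, \<open>p\<close> stands beside the error of
    \<open>w\<close>, and \<open>\<Theta>' *v w i\<close> beside the error of \<open>v\<close>.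
    Integrality bounds the former by a multiple of \<open>v\<close>, boundedness of the matrix the
    latter by a multiple of \<open>w\<close>.\<close>
  obtain K where K: "K > 0" "\<forall>\<^sub>F i in U. infnorm (p i) \<le> K * infnorm (v i)"
    using perp_le_infnorm[OF v] by blast
  obtain L where L: "L > 0" "\<And>x. infnorm (\<Theta>' *v x) \<le> L * infnorm x"
    using infnorm_matrix_vector_bound[of \<Theta>'] by blast
  from L(2) have "\<forall>\<^sub>F i in U. infnorm (\<Theta>' *v w i) \<le> L * infnorm (w i)" by simp
  from infnorm_vkron_errors[OF v w K L(1) this]
  show "\<forall>\<^sub>F i in U. infnorm (kron \<Theta> \<Theta>' *v vkron (v i) (w i) - vkron (p i) (q i)) \<le> 2 * max (b i) (k i)"
  proof eventually_elim
    case (elim i)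
    have eq: "kron \<Theta> \<Theta>' *v vkron (v i) (w i) - vkron (p i) (q i)
        = vkron (\<Theta> *v v i - p i) (\<Theta>' *v w i) + vkron (p i) (\<Theta>' *v w i - q i)"
      by (simp add: kron_mult_vkron vkron_distribs)
    have "infnorm (kron \<Theta> \<Theta>' *v vkron (v i) (w i) - vkron (p i) (q i)) \<le> k i + b i"
      unfolding eq
      using infnorm_triangle[of "vkron (\<Theta> *v v i - p i) (\<Theta>' *v w i)" "vkron (p i) (\<Theta>' *v w i - q i)"]
        elim by linarith
    with pos[of i] show ?case by (auto simp: max_def)
  qed
qed

text \<open>An identity matrix leaves its factor unchanged, so the integer approximations combine as
  \<open>p\<close> with \<open>w\<close> and \<open>v\<close> with \<open>q\<close>.\<close>

lemma seq_dioph_kron_sum_diff: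
  fixes \<Theta> :: "real ^ 'r ^ 'r" and \<Theta>' :: "real ^ 'r2 ^ 'r2"
  assumes v: "seq_dioph U m b n \<Theta> v p" and w: "seq_dioph U n k m \<Theta>' w q"
  shows "seq_dioph U (\<lambda>i. m i * n i) (\<lambda>i. b i * k i)
      (\<lambda>i. max (b i) (k i) powr (1 / CARD('r \<times> 'r2))) (kron_sum \<Theta> \<Theta>')
      (\<lambda>i. vkron (v i) (w i)) (\<lambda>i. vkron (p i) (w i) + vkron (v i) (q i))" (is ?sum)
    and "seq_dioph U (\<lambda>i. m i * n i) (\<lambda>i. b i * k i)
      (\<lambda>i. max (b i) (k i) powr (1 / CARD('r \<times> 'r2))) (kron_diff \<Theta> \<Theta>')
      (\<lambda>i. vkron (v i) (w i)) (\<lambda>i. vkron (p i) (w i) - vkron (v i) (q i))" (is ?diff)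
proof -
  \<comment> \<open>The vectors beside the errors are now \<open>v\<close> and \<open>w\<close>
    themselves, so both constants are 1.\<close>
  note errs = infnorm_vkron_errors[OF v w, of 1 v 1 w, simplified]
  show ?sum
  proof (rule seq_dioph_targetI[OF v w])
    show "(vkron (p i) (w i) + vkron (v i) (q i)) $ j \<in> \<int>" for i j
      using v w by (auto simp: seq_dioph_def vkron_def)
    from errs show "\<forall>\<^sub>F i in U. infnorm (kron_sum \<Theta> \<Theta>' *v vkron (v i) (w i)
        - (vkron (p i) (w i) + vkron (v i) (q i))) \<le> 2 * max (b i) (k i)"
    proof eventually_elim
      case (elim i)
      have eq: "kron_sum \<Theta> \<Theta>' *v vkron (v i) (w i) - (vkron (p i) (w i) + vkron (v i) (q i))
          = vkron (\<Theta> *v v i - p i) (w i) + vkron (v i) (\<Theta>' *v w i - q i)"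
        by (simp add: kron_sum_mult_vkron vkron_distribs)
      have "infnorm (kron_sum \<Theta> \<Theta>' *v vkron (v i) (w i) - (vkron (p i) (w i) + vkron (v i) (q i)))
          \<le> k i + b i"
        unfolding eq
        using infnorm_triangle[of "vkron (\<Theta> *v v i - p i) (w i)" "vkron (v i) (\<Theta>' *v w i - q i)"]
          elim by linarith
      with pos[of i] show ?case by (auto simp: max_def)
    qed
  qed
  show ?diff
  proof (rule seq_dioph_targetI[OF v w])
    show "(vkron (p i) (w i) - vkron (v i) (q i)) $ j \<in> \<int>" for i j
      using v w by (auto simp: seq_dioph_def vkron_def)
    from errs show "\<forall>\<^sub>F i in U. infnorm (kron_diff \<Theta> \<Theta>' *v vkron (v i) (w i)
        - (vkron (p i) (w i) - vkron (v i) (q i))) \<le> 2 * max (b i) (k i)"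
    proof eventually_elim
      case (elim i)
      have eq: "kron_diff \<Theta> \<Theta>' *v vkron (v i) (w i) - (vkron (p i) (w i) - vkron (v i) (q i))
          = vkron (\<Theta> *v v i - p i) (w i) - vkron (v i) (\<Theta>' *v w i - q i)"
        by (simp add: kron_diff_mult_vkron vkron_distribs)
      have "infnorm (kron_diff \<Theta> \<Theta>' *v vkron (v i) (w i) - (vkron (p i) (w i) - vkron (v i) (q i)))
          \<le> k i + b i"
        unfolding eq
        using infnorm_diff_le[of "vkron (\<Theta> *v v i - p i) (w i)" "vkron (v i) (\<Theta>' *v w i - q i)"]
          elim by linarith
      with pos[of i] show ?case by (auto simp: max_def)
    qed
  qed
qed

end

section \<open>Translation of the stated groups, and the pairings\<close>

text \<open>The exponents of the source groups cancel the roots in the definition of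
  \<open>fdioph_group\<close>, leaving the sequences \<open>a\<close> and \<open>c\<close>
  themselves.\<close>

lemma fdioph_group_powers:
  fixes \<Theta> :: "real ^ 's ^ 'r"
  assumes nu: "nonprincipal_ultrafilter U"
    and pos: "\<And>i. 0 < a i" "\<And>i. 0 < b i" "\<And>i. 0 < c i"
  shows "fdioph_group U (ppow U (pcls U (ucls U a)) CARD('s)) (pcls U (ucls U b))
      (ppow U (pcls U (ucls U c)) CARD('r)) \<Theta>
    = {N. \<exists>v p. N = uvec U v \<and> seq_dioph U a b c \<Theta> v p}"
proof -
  have abs: "\<bar>a i\<bar> = a i" "\<bar>c i\<bar> = c i" for i using pos[of i] by simp_all
  have "N \<in> fdioph_group U (pcls U (ucls U (\<lambda>i. a i powr CARD('s)))) (pcls U (ucls U b))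
      (pcls U (ucls U (\<lambda>i. c i powr CARD('r)))) \<Theta> \<longleftrightarrow> (\<exists>v p. N = uvec U v \<and> seq_dioph U a b c \<Theta> v p)" for N
    by (subst mem_fdioph_group_iff[OF nu]) (use pos in \<open>simp_all add: powr_powr less_imp_neq[symmetric] less_imp_le\<close>)
  then show ?thesis by (auto simp: ppow_pcls[OF nu] abs)
qed

text \<open>In the upper index the powers again cancel the root, so the weight is
  \<open>m i * n i\<close>; the lower index carries no power and keeps its root. The parameter
  \<open>t\<close> allows a product of cardinalities as exponent for a product index type.\<close>

lemma fdioph_group_target:
  fixes \<Theta> :: "real ^ 's ^ 'r"
  assumes nu: "nonprincipal_ultrafilter U" and t: "t = real CARD('s)"
    and pos: "\<And>i. 0 < m i" "\<And>i. 0 < n i" "\<And>i. 0 < b i" "\<And>i. 0 < k i"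
  shows "fdioph_group U (pmult U (ppow U (pcls U (ucls U m)) t) (ppow U (pcls U (ucls U n)) t))
      (pmult U (pcls U (ucls U b)) (pcls U (ucls U k)))
      (padd U (pcls U (ucls U b)) (pcls U (ucls U k))) \<Theta>
    = {N. \<exists>v p. N = uvec U v \<and> seq_dioph U (\<lambda>i. m i * n i) (\<lambda>i. b i * k i)
        (\<lambda>i. max (b i) (k i) powr (1 / CARD('r))) \<Theta> v p}"
proof -
  have abs: "\<bar>m i\<bar> = m i" "\<bar>n i\<bar> = n i" "\<bar>b i\<bar> = b i" "\<bar>k i\<bar> = k i" for i using pos[of i] by simp_all
  have pw: "(m i powr t * n i powr t) powr (1 / CARD('s)) = m i * n i" for i
    using pos[of i] by (simp add: t powr_mult[symmetric] powr_powr)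
  have "padd U (pcls U (ucls U b)) (pcls U (ucls U k)) = pcls U (ucls U (\<lambda>i. max (b i) (k i)))"
    by (rule padd_pcls[OF nu]) (simp add: abs)
  moreover have "t \<ge> 0" by (simp add: t)
  moreover have "N \<in> fdioph_group U (pcls U (ucls U (\<lambda>i. m i powr t * n i powr t)))
      (pcls U (ucls U (\<lambda>i. b i * k i))) (pcls U (ucls U (\<lambda>i. max (b i) (k i)))) \<Theta> \<longleftrightarrow>
      (\<exists>v p. N = uvec U v \<and> seq_dioph U (\<lambda>i. m i * n i) (\<lambda>i. b i * k i)
        (\<lambda>i. max (b i) (k i) powr (1 / CARD('r))) \<Theta> v p)" for N
    by (subst mem_fdioph_group_iff[OF nu])
      (use pos in \<open>simp_all add: pw less_max_iff_disj less_imp_neq[symmetric]\<close>)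
  ultimately show ?thesis by (auto simp: ppow_pcls[OF nu] pmult_pcls[OF nu] abs)
qed

theorem theorem25:
  fixes U :: "nat filter" and \<mu> \<nu> \<iota> \<kappa> :: "real ultra set"
  assumes "nonprincipal_ultrafilter U"
    and "\<mu> \<in> PP_eps U" and "\<nu> \<in> PP_eps U" and "\<iota> \<in> PP_eps U" and "\<kappa> \<in> PP_eps U"
  shows
    "(\<forall>(\<Theta> :: real ^ 's ^ 'r) (\<Theta>' :: real ^ 's2 ^ 'r2).
        bilinear_pairing (hvec_kron U)
          (hvec_group U
            (fdioph_group U (ppow U \<mu> CARD('s)) \<iota> (ppow U \<nu> CARD('r)) \<Theta>))
          (hvec_group U
            (fdioph_group U (ppow U \<nu> CARD('s2)) \<kappa> (ppow U \<mu> CARD('r2)) \<Theta>'))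
          (hvec_group U
            (fdioph_group U
              (pmult U (ppow U \<mu> (CARD('s) * CARD('s2))) (ppow U \<nu> (CARD('s) * CARD('s2))))
              (pmult U \<iota> \<kappa>) (padd U \<iota> \<kappa>) (kron \<Theta> \<Theta>'))))
     \<and>
     (\<forall>(\<Theta> :: real ^ 'r ^ 'r) (\<Theta>' :: real ^ 'r2 ^ 'r2).
        bilinear_pairing (hvec_kron U)
          (hvec_group U
            (fdioph_group U (ppow U \<mu> CARD('r)) \<iota> (ppow U \<nu> CARD('r)) \<Theta>))
          (hvec_group U
            (fdioph_group U (ppow U \<nu> CARD('r2)) \<kappa> (ppow U \<mu> CARD('r2)) \<Theta>'))
          (hvec_group U
            (fdioph_group U
               (pmult U (ppow U \<mu> (CARD('r) * CARD('r2))) (ppow U \<nu> (CARD('r) * CARD('r2))))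
               (pmult U \<iota> \<kappa>) (padd U \<iota> \<kappa>) (kron_sum \<Theta> \<Theta>')
             \<inter>
             fdioph_group U
               (pmult U (ppow U \<mu> (CARD('r) * CARD('r2))) (ppow U \<nu> (CARD('r) * CARD('r2))))
               (pmult U \<iota> \<kappa>) (padd U \<iota> \<kappa>) (kron_diff \<Theta> \<Theta>'))))"
proof -
  note nu = assms(1)
  obtain m where m: "\<mu> = pcls U (ucls U m)" "\<And>i. 0 < m i"
    using PP_eps_representative[OF nu assms(2)] by blast
  obtain n where n: "\<nu> = pcls U (ucls U n)" "\<And>i. 0 < n i"
    using PP_eps_representative[OF nu assms(3)] by blast
  obtain b where b: "\<iota> = pcls U (ucls U b)" "\<And>i. 0 < b i" "\<forall>d>0. \<forall>\<^sub>F i in U. b i < d"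
    using PP_eps_representative[OF nu assms(4)] by blast
  obtain k where k: "\<kappa> = pcls U (ucls U k)" "\<And>i. 0 < k i" "\<forall>d>0. \<forall>\<^sub>F i in U. k i < d"
    using PP_eps_representative[OF nu assms(5)] by blast
  note pos = m(2) n(2) b(2) k(2)
  have target_pos: "0 < m i * n i" "0 < b i * k i" "0 < max (b i) (k i) powr t" for i t
    using pos[of i] by (simp_all add: less_max_iff_disj)
  show ?thesis
  proof (intro conjI allI)
    fix \<Theta> :: "real ^ 's ^ 'r" and \<Theta>' :: "real ^ 's2 ^ 'r2"
    \<comment> \<open>Matches the exponent in the statement with the cardinality of the product
      index type.\<close>
    have cd: "real (CARD('s) * CARD('s2)) = real CARD('s \<times> 's2)" by simp
    show "bilinear_pairing (hvec_kron U)
          (hvec_group U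
            (fdioph_group U (ppow U \<mu> CARD('s)) \<iota> (ppow U \<nu> CARD('r)) \<Theta>))
          (hvec_group U
            (fdioph_group U (ppow U \<nu> CARD('s2)) \<kappa> (ppow U \<mu> CARD('r2)) \<Theta>'))
          (hvec_group U
            (fdioph_group U
              (pmult U (ppow U \<mu> (CARD('s) * CARD('s2))) (ppow U \<nu> (CARD('s) * CARD('s2))))
              (pmult U \<iota> \<kappa>) (padd U \<iota> \<kappa>) (kron \<Theta> \<Theta>')))"
      \<comment> \<open>All three groups become sets described by \<open>seq_dioph\<close>, so only
        the containment of products and the subgroup laws remain.\<close>
      unfolding m(1) n(1) b(1) k(1) fdioph_group_powers[OF nu m(2) b(2) n(2)]
        fdioph_group_powers[OF nu n(2) k(2) m(2)] fdioph_group_target[OF nu cd pos]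
    proof (rule bilinear_pairing_hvec_kron)
      fix M N assume "M \<in> {N. \<exists>v p. N = uvec U v \<and> seq_dioph U m b n \<Theta> v p}"
        "N \<in> {N. \<exists>v p. N = uvec U v \<and> seq_dioph U n k m \<Theta>' v p}"
      then obtain v p w q where MN: "M = uvec U v" "N = uvec U w"
        and vw: "seq_dioph U m b n \<Theta> v p" "seq_dioph U n k m \<Theta>' w q" by blast
      show "hvec_kron U M N \<in> {N. \<exists>v p. N = uvec U v \<and> seq_dioph U (\<lambda>i. m i * n i) (\<lambda>i. b i * k i)
        (\<lambda>i. max (b i) (k i) powr (1 / CARD('r \<times> 'r2))) (kron \<Theta> \<Theta>') v p}"
        using seq_dioph_kron[OF nu pos b(3) k(3) vw] unfolding MN hvec_kron_uvec by blast
    qed (intro uvec_subgroup_seq_dioph pos target_pos)+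
  next
    fix \<Theta> :: "real ^ 'r ^ 'r" and \<Theta>' :: "real ^ 'r2 ^ 'r2"
    have cd: "real (CARD('r) * CARD('r2)) = real CARD('r \<times> 'r2)" by simp
    show "bilinear_pairing (hvec_kron U)
          (hvec_group U
            (fdioph_group U (ppow U \<mu> CARD('r)) \<iota> (ppow U \<nu> CARD('r)) \<Theta>))
          (hvec_group U
            (fdioph_group U (ppow U \<nu> CARD('r2)) \<kappa> (ppow U \<mu> CARD('r2)) \<Theta>'))
          (hvec_group U
            (fdioph_group U
               (pmult U (ppow U \<mu> (CARD('r) * CARD('r2))) (ppow U \<nu> (CARD('r) * CARD('r2))))
               (pmult U \<iota> \<kappa>) (padd U \<iota> \<kappa>) (kron_sum \<Theta> \<Theta>')
             \<inter>
             fdioph_group U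
               (pmult U (ppow U \<mu> (CARD('r) * CARD('r2))) (ppow U \<nu> (CARD('r) * CARD('r2))))
               (pmult U \<iota> \<kappa>) (padd U \<iota> \<kappa>) (kron_diff \<Theta> \<Theta>')))"
      unfolding m(1) n(1) b(1) k(1) fdioph_group_powers[OF nu m(2) b(2) n(2)]
        fdioph_group_powers[OF nu n(2) k(2) m(2)] fdioph_group_target[OF nu cd pos]
    proof (rule bilinear_pairing_hvec_kron)
      fix M N assume "M \<in> {N. \<exists>v p. N = uvec U v \<and> seq_dioph U m b n \<Theta> v p}"
        "N \<in> {N. \<exists>v p. N = uvec U v \<and> seq_dioph U n k m \<Theta>' v p}"
      then obtain v p w q where MN: "M = uvec U v" "N = uvec U w"
        and vw: "seq_dioph U m b n \<Theta> v p" "seq_dioph U n k m \<Theta>' w q" by blast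
      \<comment> \<open>The same product lies in both groups, with different integer approximations:
        the sum and the difference of the same two Kronecker products.\<close>
      show "hvec_kron U M N \<in>
          {N. \<exists>v p. N = uvec U v \<and> seq_dioph U (\<lambda>i. m i * n i) (\<lambda>i. b i * k i)
            (\<lambda>i. max (b i) (k i) powr (1 / CARD('r \<times> 'r2))) (kron_sum \<Theta> \<Theta>') v p} \<inter>
          {N. \<exists>v p. N = uvec U v \<and> seq_dioph U (\<lambda>i. m i * n i) (\<lambda>i. b i * k i)
            (\<lambda>i. max (b i) (k i) powr (1 / CARD('r \<times> 'r2))) (kron_diff \<Theta> \<Theta>') v p}"
        using seq_dioph_kron_sum_diff[OF nu pos b(3) k(3) vw] unfolding MN hvec_kron_uvec by blast
    qed (intro uvec_subgroup_Int uvec_subgroup_seq_dioph pos target_pos)+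
  qed
qed

end
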